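(* Let $X[n,d]$ denote the number of vertices of degree $d$ after $n$ steps in the random graph process (version 1) described in the context. Then there is a (deterministic) sequence $(c_d)_{d\ge 0}$ of positive numbers such that for every integer $d\ge 0$ $$\frac{X[n,d]}{n+1}\to c_d\quad\text{almost surely as } n\to\infty,$$ and $(c_d)$ satisfies $$c_0=\frac{1+c_1}{3},\qquad c_d=\frac{d+1}{2d+3}\bigl(c_{d-1}+c_{d+1}\bigr)\quad (d\ge 1).$$
   Context: Random graph process, version 1: the process starts (after $0$ steps) with the graph consisting of a single vertex and no edges. It evolves in discrete steps; one new vertex is born at each step, so there are $n+1$ vertices after $n$ steps. The graph is always simple. At each step, two (not necessarily different) old vertices $u,v$ (i.e. vertices already present before the step) are chosen independently of each other and of the past, each uniformly at random among all old vertices. Duplication part: the new vertex is added to the graph and connected by an edge to $u$ and to every neighbour of $u$. Deletion part: afterwards, all edges emanating from $v$ are deleted, except that edges incident to the new vertex are not deleted (so if $v$ is connected to the new vertex, that edge is kept). *)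

theory Defs
  imports "HOL-Probability.Probability"
begin

text \<open>A simple graph is represented by its set of edges, each edge being a two-element set of
  vertices. Vertices are named by their time of birth: the initial vertex is \<open>0\<close> and the vertex
  born at step \<open>n\<close> is \<open>n\<close>, so the vertex set after \<open>n\<close> steps is \<open>{..n}\<close>.\<close>

definition neighbours :: "nat set set \<Rightarrow> nat \<Rightarrow> nat set" where
  "neighbours E x = {y. {x, y} \<in> E}"

definition degree :: "nat set set \<Rightarrow> nat \<Rightarrow> nat" where
  "degree E x = card (neighbours E x)"

definition duplicate :: "nat \<Rightarrow> nat \<Rightarrow> nat set set \<Rightarrow> nat set set" where
  "duplicate w u E = E \<union> {{w, x} | x. x \<in> insert u (neighbours E u)}"

definition delete_edges :: "nat \<Rightarrow> nat \<Rightarrow> nat set set \<Rightarrow> nat set set" where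
  "delete_edges w v E = E - {e \<in> E. v \<in> e \<and> w \<notin> e}"

text \<open>In step \<open>n + 1\<close> the old vertices are \<open>{..n}\<close>, the new vertex is \<open>Suc n\<close>, and \<open>u n\<close> and \<open>v n\<close>
  are the old vertices chosen for duplication and for deletion, respectively.\<close>

primrec process_edges :: "(nat \<Rightarrow> nat) \<Rightarrow> (nat \<Rightarrow> nat) \<Rightarrow> nat \<Rightarrow> nat set set" where
  "process_edges u v 0 = {}"
| "process_edges u v (Suc n) =
     delete_edges (Suc n) (v n) (duplicate (Suc n) (u n) (process_edges u v n))"

lemma process_edges_simple:
  assumes "\<And>n. u n \<le> n" and "e \<in> process_edges u v n"
  shows "e \<subseteq> {..n} \<and> card e = 2"
  using assms(2)
proof (induction n arbitrary: e)
  case 0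
  then show ?case by simp
next
  case (Suc n)
  consider "e \<in> process_edges u v n"
    | x where "e = {Suc n, x}" "x = u n \<or> {u n, x} \<in> process_edges u v n"
    using Suc.prems by (auto simp: delete_edges_def duplicate_def neighbours_def)
  then show ?case
  proof cases
    case 1
    with Suc.IH[of e] show ?thesis by auto
  next
    case 2
    then have "x \<le> n" using Suc.IH[of "{u n, x}"] assms(1)[of n] by auto
    with 2 show ?thesis by auto
  qed
qed

definition num_degree :: "(nat \<Rightarrow> nat) \<Rightarrow> (nat \<Rightarrow> nat) \<Rightarrow> nat \<Rightarrow> nat \<Rightarrow> nat" where
  "num_degree u v n d = card {x \<in> {..n}. degree (process_edges u v n) x = d}"

text \<open>The graph is a function of the choices made so far, so that independence of each choice from
  the past and from the other choice in the same step amounts to joint independence of the whole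
  family \<open>U 0, V 0, U 1, V 1, \<dots>\<close>, which is indexed here by a sum type.\<close>

locale duplication_deletion_process = prob_space M for M :: "'a measure" +
  fixes U V :: "nat \<Rightarrow> 'a \<Rightarrow> nat"
  assumes choices_indep: "indep_vars (\<lambda>_. count_space UNIV) (case_sum U V) UNIV"
    and U_uniform: "\<And>n. distr M (count_space UNIV) (U n) = measure_pmf (pmf_of_set {..n})"
    and V_uniform: "\<And>n. distr M (count_space UNIV) (V n) = measure_pmf (pmf_of_set {..n})"

end

theory Submission
  imports Defs
begin

text \<open>
  Write \<open>N = n + 1\<close> and let \<open>x\<^sub>n(d)\<close> be the proportion of vertices of degree \<open>d\<close> after \<open>n\<close> steps.
  An old vertex of degree \<open>k\<close> gains an edge when \<open>u\<close> falls into its closed neighbourhood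
  (probability \<open>(k + 1) / N\<close>), loses one when \<open>v\<close> is one of its neighbours (probability \<open>k / N\<close>) and is
  stripped when it is \<open>v\<close> itself (probability \<open>1 / N\<close>); moreover it is duplicated, as a vertex of degree
  \<open>k + 1\<close>, with probability \<open>1 / N\<close>. Hence, given the past, the expected increment of \<open>N x\<^sub>n(d)\<close> is
  \<open>(d + 1) (x\<^sub>n(d - 1) + x\<^sub>n(d + 1)) - 2 (d + 1) x\<^sub>n(d) + [d = 0]\<close> up to an error of order
  \<open>1 / N\<close> plus (sum of degrees) \<open>/ N\<^sup>2\<close>, the latter because a stripped vertex keeps one edge when
  \<open>u\<close> was in its closed neighbourhood (\<open>drift_indicator\<close>). Setting the drift
  equal to \<open>x\<^sub>n(d)\<close> gives the recursion of the theorem.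

  Two ingredients turn this heuristic into a proof. The first is probabilistic. A single step can change
  many degrees at once, so increments are not bounded; but the sum of \<open>degree + 1\<close> over all
  vertices grows by \<open>3\<close> per step in expectation, and the sum of \<open>(degree + 1)\<^sup>2\<close> by at most \<open>19\<close>
  (\<open>expectation_stat_linear\<close>, \<open>expectation_stat_square\<close>). Therefore the martingale part of \<open>N x\<^sub>n(d)\<close> has increments
  with bounded second moments and is \<open>o(n)\<close> almost surely (\<open>noise_slln\<close>), and the same
  moments make the error terms vanish (\<open>mean_degree_negligible\<close>).

  The second is deterministic and concerns one path at a time. The equation for \<open>x\<^sub>n(d)\<close> involves
  \<open>x\<^sub>n(d + 1)\<close>, so the system cannot be solved degree by degree. Instead let \<open>b\<^sub>d\<close> and \<open>a\<^sub>d\<close> be the upper and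
  lower limits of \<open>x\<^sub>n(d)\<close>. The damping \<open>- 2 (d + 1) x\<^sub>n(d)\<close> forces \<open>b\<close> to satisfy the recursion with
  \<open>\<le>\<close> and \<open>a\<close> with \<open>\<ge>\<close> (\<open>noisy_relaxation_bound\<close>), so \<open>b - a\<close> is a nonnegative subsolution of the
  homogeneous recursion, bounded by \<open>1\<close>. Such a subsolution is zero, since a nonzero one would grow at
  least linearly in \<open>d\<close> (\<open>bounded_subsolution_zero\<close>). So almost every path has limits, and they solve
  the recursion. The same growth argument shows that the recursion has only one solution
  with values in \<open>[0, 1]\<close>; hence the limits do not depend on the path.
\<close>

section \<open>Bounded solutions of the degree recursion\<close>

text \<open>The hypothesis \<open>sub\<close> is \<open>\<delta> (d + 1) - \<delta> d \<ge> (\<delta> d - \<delta> (d - 1)) + \<delta> d / (d + 1)\<close>, with \<open>\<delta> (- 1)\<close> read as \<open>0\<close>.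
  So \<open>\<delta>\<close> is nondecreasing and convex; once it is positive its increments are bounded
  below by a positive constant and it is unbounded.\<close>

lemma bounded_subsolution_zero:
  fixes \<delta> :: "nat \<Rightarrow> real"
  assumes nonneg: "\<And>d. 0 \<le> \<delta> d" and bdd: "\<And>d. \<delta> d \<le> B"
    and sub: "\<And>d. (2 * real d + 3) * \<delta> d
      \<le> (real d + 1) * ((if d = 0 then 0 else \<delta> (d - 1)) + \<delta> (Suc d))"
  shows "\<delta> d = 0"
proof -
  have diff: "\<delta> (Suc d) - \<delta> d \<ge> \<delta> d - (if d = 0 then 0 else \<delta> (d - 1)) + \<delta> d / (real d + 1)" for d
    using sub[of d] by (simp add: field_simps)
  have mono: "\<delta> d \<le> \<delta> (Suc d)" for d
  proof (induction d)
    case 0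
    then show ?case using diff[of 0] nonneg[of 0] by simp
  next
    case (Suc d)
    have "0 \<le> \<delta> (Suc d) / (real (Suc d) + 1)" using nonneg by simp
    then show ?case using diff[of "Suc d"] Suc by simp
  qed
  show ?thesis
  proof (rule ccontr)
    assume "\<delta> d \<noteq> 0"
    then have pos: "\<delta> d > 0" using nonneg[of d] by simp
    \<comment> \<open>a lower bound for every increment from \<open>d\<close> on\<close>
    define \<eta> where "\<eta> = \<delta> d / (real d + 1)"
    have \<eta>: "\<eta> > 0" using pos by (simp add: \<eta>_def)
    have inc: "\<eta> \<le> \<delta> (Suc (d + j)) - \<delta> (d + j)" for j
    proof (induction j)
      case 0
      have "(if d = 0 then 0 else \<delta> (d - 1)) \<le> \<delta> d"
        using mono[of "d - 1"] nonneg[of d] by (cases d) auto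
      then show ?case using diff[of d] by (simp add: \<eta>_def)
    next
      case (Suc j)
      have "0 \<le> \<delta> (Suc (d + j)) / (real (Suc (d + j)) + 1)" using nonneg by simp
      then show ?case using diff[of "Suc (d + j)"] Suc by simp
    qed
    have grow: "real j * \<eta> \<le> \<delta> (d + j)" for j
    proof (induction j)
      case (Suc j)
      then show ?case using inc[of j] by (simp add: algebra_simps)
    qed (use nonneg in simp)
    obtain j :: nat where "B < real j * \<eta>" using reals_Archimedean3[OF \<eta>] by blast
    with grow[of j] bdd[of "d + j"] show False by linarith
  qed
qed

text \<open>By the triangle inequality, the absolute difference of two solutions is a subsolution of the
  homogeneous recursion.\<close>

lemma bounded_solution_unique:
  fixes c c' :: "nat \<Rightarrow> real"
  assumes c: "\<And>d. 0 \<le> c d" "\<And>d. c d \<le> 1" "\<And>d. 0 \<le> c' d" "\<And>d. c' d \<le> 1"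
    and r: "\<And>d. (2 * real d + 3) * c d
      = (real d + 1) * ((if d = 0 then 0 else c (d - 1)) + c (Suc d)) + of_bool (d = 0)"
    and r': "\<And>d. (2 * real d + 3) * c' d
      = (real d + 1) * ((if d = 0 then 0 else c' (d - 1)) + c' (Suc d)) + of_bool (d = 0)"
  shows "c = c'"
proof
  fix d
  have "\<bar>c d - c' d\<bar> = 0"
  proof (rule bounded_subsolution_zero[of "\<lambda>d. \<bar>c d - c' d\<bar>" 1])
    show "\<bar>c d - c' d\<bar> \<le> 1" for d using c[of d] by (auto simp: abs_le_iff)
    fix d
    have "(2 * real d + 3) * \<bar>c d - c' d\<bar> = \<bar>(2 * real d + 3) * c d - (2 * real d + 3) * c' d\<bar>"
      by (simp add: right_diff_distrib[symmetric] abs_mult)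
    also have "\<dots> = (real d + 1) * \<bar>(if d = 0 then 0 else c (d - 1) - c' (d - 1)) + (c (Suc d) - c' (Suc d))\<bar>"
    proof -
      have "(2 * real d + 3) * c d - (2 * real d + 3) * c' d = (real d + 1) *
          ((if d = 0 then 0 else c (d - 1) - c' (d - 1)) + (c (Suc d) - c' (Suc d)))"
        unfolding r r' by (simp add: algebra_simps)
      then show ?thesis by (simp add: abs_mult)
    qed
    also have "\<dots> \<le> (real d + 1) * ((if d = 0 then 0 else \<bar>c (d - 1) - c' (d - 1)\<bar>) + \<bar>c (Suc d) - c' (Suc d)\<bar>)"
      by (intro mult_left_mono) auto
    finally show "(2 * real d + 3) * \<bar>c d - c' d\<bar> \<le> \<dots>" .
  qed simp
  then show "c d = c' d" by simp
qed

section \<open>Limits of noisy linear systems\<close>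

text \<open>This says that the limit superior of \<open>x\<close> is at most \<open>B\<close>, but stays within the real numbers; lower
  limits are handled by passing to \<open>- x\<close>.\<close>

definition eventual_bound :: "(nat \<Rightarrow> real) \<Rightarrow> real \<Rightarrow> bool" where
  "eventual_bound x B \<longleftrightarrow> (\<forall>\<epsilon>>0. \<forall>\<^sub>F n in sequentially. x n \<le> B + \<epsilon>)"

lemma eventual_boundD: "eventual_bound x B \<Longrightarrow> \<epsilon> > 0 \<Longrightarrow> \<forall>\<^sub>F n in sequentially. x n \<le> B + \<epsilon>"
  by (simp add: eventual_bound_def)

lemma eventual_bound_const: "(\<And>n. x n \<le> B) \<Longrightarrow> eventual_bound x B"
  by (auto simp: eventual_bound_def intro!: always_eventually add_increasing2)

lemma eventual_bound_mono:
  assumes "eventual_bound y B" "\<forall>\<^sub>F n in sequentially. x n \<le> y n"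
  shows "eventual_bound x B"
  unfolding eventual_bound_def
proof (intro allI impI)
  fix \<epsilon> :: real assume "\<epsilon> > 0"
  from eventual_boundD[OF assms(1) this] assms(2)
  show "\<forall>\<^sub>F n in sequentially. x n \<le> B + \<epsilon>" by eventually_elim simp
qed

lemma eventual_bound_add:
  assumes "eventual_bound x A" "eventual_bound y B"
  shows "eventual_bound (\<lambda>n. x n + y n) (A + B)"
  unfolding eventual_bound_def
proof (intro allI impI)
  fix \<epsilon> :: real assume "\<epsilon> > 0"
  then have "\<forall>\<^sub>F n in sequentially. x n \<le> A + \<epsilon> / 2" "\<forall>\<^sub>F n in sequentially. y n \<le> B + \<epsilon> / 2"
    using assms by (auto intro: eventual_boundD)
  then show "\<forall>\<^sub>F n in sequentially. x n + y n \<le> A + B + \<epsilon>"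
    by eventually_elim simp
qed

lemma eventual_bound_cmult:
  assumes "eventual_bound x A" "c \<ge> 0"
  shows "eventual_bound (\<lambda>n. c * x n) (c * A)"
  unfolding eventual_bound_def
proof (intro allI impI)
  fix \<epsilon> :: real assume \<epsilon>: "\<epsilon> > 0"
  then have "\<forall>\<^sub>F n in sequentially. x n \<le> A + \<epsilon> / (c + 1)"
    using assms by (intro eventual_boundD) auto
  then show "\<forall>\<^sub>F n in sequentially. c * x n \<le> c * A + \<epsilon>"
  proof eventually_elim
    case (elim n)
    then have "c * x n \<le> c * (A + \<epsilon> / (c + 1))" using assms(2) by (rule mult_left_mono)
    also have "\<dots> \<le> c * A + \<epsilon>" using assms(2) \<epsilon> by (simp add: field_simps)
    finally show ?case .
  qed
qed

lemma eventual_bound_tendsto: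
  assumes "x \<longlonglongrightarrow> A"
  shows "eventual_bound x A"
  unfolding eventual_bound_def
proof (intro allI impI)
  fix \<epsilon> :: real assume "\<epsilon> > 0"
  then have "\<forall>\<^sub>F n in sequentially. x n < A + \<epsilon>" using assms by (intro order_tendstoD(2)) auto
  then show "\<forall>\<^sub>F n in sequentially. x n \<le> A + \<epsilon>" by eventually_elim simp
qed

lemma eventual_bounds_le:
  assumes "eventual_bound x B" "eventual_bound (\<lambda>n. - x n) (- A)"
  shows "A \<le> B"
proof (rule field_le_epsilon)
  fix \<epsilon> :: real assume "\<epsilon> > 0"
  then have "\<epsilon> / 2 > 0" by simp
  note eventual_boundD[OF assms(1) this] eventual_boundD[OF assms(2) this]
  then have "\<forall>\<^sub>F n in sequentially. A \<le> B + \<epsilon>" by eventually_elim simp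
  then show "A \<le> B + \<epsilon>" by simp
qed

lemma eventual_bounds_tendsto:
  assumes "eventual_bound x A" "eventual_bound (\<lambda>n. - x n) (- A)"
  shows "x \<longlonglongrightarrow> A"
proof (rule tendstoI)
  fix \<epsilon> :: real assume "\<epsilon> > 0"
  then have "\<epsilon> / 2 > 0" by simp
  note eventual_boundD[OF assms(1) this] eventual_boundD[OF assms(2) this]
  then show "\<forall>\<^sub>F n in sequentially. dist (x n) A < \<epsilon>"
    by eventually_elim (use \<open>\<epsilon> > 0\<close> in \<open>auto simp: dist_real_def abs_less_iff\<close>)
qed

text \<open>The number obtained is the limit superior of the bounded sequence \<open>x\<close>; the last property is what
  allows an inequality between bounds to be transferred to it.\<close>

lemma least_eventual_bound:
  assumes x: "\<And>n. l \<le> x n" "\<And>n. x n \<le> u"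
  obtains b where "l \<le> b" "b \<le> u" "eventual_bound x b" "\<And>B. eventual_bound x B \<Longrightarrow> b \<le> B"
proof -
  let ?S = "{B. eventual_bound x B}"
  define b where "b = Inf ?S"
  have u: "u \<in> ?S" using x(2) by (simp add: eventual_bound_const)
  have l: "l \<le> B" if "B \<in> ?S" for B
  proof -
    have "eventual_bound (\<lambda>n. - x n) (- l)"
      using x(1) by (intro eventual_bound_const) auto
    then show ?thesis using that by (intro eventual_bounds_le[of x]) auto
  qed
  have low: "b \<le> B" if "B \<in> ?S" for B
    unfolding b_def using that l by (intro cInf_lower) (auto simp: bdd_below_def)
  have "eventual_bound x b"
    unfolding eventual_bound_def
  proof (intro allI impI)
    fix \<epsilon> :: real assume \<epsilon>: "\<epsilon> > 0"
    then obtain B where B: "B \<in> ?S" "B < b + \<epsilon> / 2"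
      using cInf_lessD[of ?S "b + \<epsilon> / 2"] u unfolding b_def by auto
    then have "\<forall>\<^sub>F n in sequentially. x n \<le> B + \<epsilon> / 2" using \<epsilon> by (auto intro: eventual_boundD)
    then show "\<forall>\<^sub>F n in sequentially. x n \<le> b + \<epsilon>" by (rule eventually_mono) (use B(2) in simp)
  qed
  moreover have "l \<le> b" unfolding b_def using u l by (intro cInf_greatest) auto
  ultimately show ?thesis using that low u by auto
qed

text \<open>At \<open>z = s N\<close> with \<open>s = a / (1 + \<gamma>)\<close>, the damping \<open>\<gamma> s\<close> and the drift \<open>a\<close> leave a net growth of
  exactly \<open>s\<close> per step, which keeps \<open>z\<close> on the line \<open>s N\<close>. An excess over this line is multiplied by at most
  \<open>1 - \<gamma> / N\<close> in each step, so it stays bounded and disappears after division by \<open>N\<close>.\<close>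

lemma relaxation_bound:
  fixes z w :: "nat \<Rightarrow> real"
  assumes g: "\<gamma> \<ge> 0" and z: "\<And>n. z (Suc n) = (1 - \<gamma> / (real n + 1)) * z n + w n"
    and w: "\<forall>\<^sub>F n in sequentially. w n \<le> a"
  shows "eventual_bound (\<lambda>n. z n / (real n + 1)) (a / (1 + \<gamma>))"
proof -
  define s where "s = a / (1 + \<gamma>)"
  have s: "s * (1 + \<gamma>) = a" using g by (simp add: s_def)
  \<comment> \<open>the excess over the stationary line\<close>
  define t where "t n = z n - s * (real n + 1)" for n
  obtain n1 where n1: "\<And>n. n \<ge> n1 \<Longrightarrow> w n \<le> a" using w by (auto simp: eventually_sequentially)
  \<comment> \<open>from here on the factor \<open>1 - \<gamma> / N\<close> lies in \<open>[0, 1]\<close>\<close>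
  define m where "m = max n1 (nat \<lceil>\<gamma>\<rceil>)"
  have t_Suc: "max 0 (t (Suc n)) \<le> max 0 (t n)" if "n \<ge> m" for n
  proof -
    have n: "n \<ge> n1" "\<gamma> \<le> real n + 1" using that by (auto simp: m_def)
    then have f: "0 \<le> 1 - \<gamma> / (real n + 1)" "1 - \<gamma> / (real n + 1) \<le> 1"
      using g by (simp_all add: field_simps)
    have "t (Suc n) \<le> (1 - \<gamma> / (real n + 1)) * z n + a - s * (real n + 2)"
      using n1[OF n(1)] by (simp add: t_def z algebra_simps)
    also have "\<dots> = (1 - \<gamma> / (real n + 1)) * t n"
      unfolding s[symmetric] t_def by (simp add: field_simps)
    also have "\<dots> \<le> (1 - \<gamma> / (real n + 1)) * max 0 (t n)" using f by (intro mult_left_mono) auto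
    also have "\<dots> \<le> 1 * max 0 (t n)" using f by (intro mult_right_mono) auto
    finally show ?thesis by simp
  qed
  have t_le: "t n \<le> max 0 (t m)" if "n \<ge> m" for n
  proof -
    have "max 0 (t n) \<le> max 0 (t m)"
      using that
    proof (induction n rule: dec_induct)
      case (step n)
      then show ?case using t_Suc[of n] by linarith
    qed simp
    then show ?thesis by simp
  qed
  have "(\<lambda>n. s + max 0 (t m) / (real n + 1)) \<longlonglongrightarrow> s + 0"
    using LIMSEQ_Suc[OF lim_const_over_n[of "max 0 (t m)"]]
    by (intro tendsto_add tendsto_const) (simp add: add.commute)
  then have "eventual_bound (\<lambda>n. s + max 0 (t m) / (real n + 1)) s"
    by (intro eventual_bound_tendsto) simp
  moreover have "\<forall>\<^sub>F n in sequentially. z n / (real n + 1) \<le> s + max 0 (t m) / (real n + 1)"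
  proof (rule eventually_sequentiallyI)
    fix n assume "m \<le> n"
    then have "z n \<le> s * (real n + 1) + max 0 (t m)" using t_le[of n] by (simp add: t_def)
    then have "z n / (real n + 1) \<le> (s * (real n + 1) + max 0 (t m)) / (real n + 1)"
      by (rule divide_right_mono) simp
    also have "\<dots> = s + max 0 (t m) / (real n + 1)" by (simp add: add_divide_distrib)
    finally show "z n / (real n + 1) \<le> s + max 0 (t m) / (real n + 1)" .
  qed
  ultimately show ?thesis
    unfolding s_def[symmetric] by (rule eventual_bound_mono)
qed

text \<open>Subtracting the noise \<open>m\<close> from \<open>N x\<close> gives a sequence \<open>z\<close> that
  obeys the noiseless recursion, and the price is the term \<open>- \<gamma> m / N\<close> in the drift, which tends to zero.\<close>

lemma noisy_relaxation_bound:
  fixes x m g :: "nat \<Rightarrow> real"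
  assumes \<gamma>: "\<gamma> \<ge> 0"
    and rec: "\<And>n. (real n + 2) * x (Suc n) - m (Suc n) = (real n + 1) * x n - m n - \<gamma> * x n + g n"
    and m: "(\<lambda>n. m n / (real n + 1)) \<longlonglongrightarrow> 0"
    and g: "eventual_bound g a"
  shows "eventual_bound x (a / (1 + \<gamma>))"
proof -
  define z where "z n = (real n + 1) * x n - m n" for n
  have z_Suc: "z (Suc n) = (1 - \<gamma> / (real n + 1)) * z n + (g n + (- \<gamma>) * (m n / (real n + 1)))" for n
  proof -
    have "z (Suc n) = z n - \<gamma> * x n + g n" using rec[of n] by (simp add: z_def algebra_simps)
    moreover have "\<gamma> / (real n + 1) * z n = \<gamma> * x n - \<gamma> * (m n / (real n + 1))"
      by (simp add: z_def field_simps)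
    ultimately show ?thesis by (simp add: left_diff_distrib)
  qed
  have "(\<lambda>n. (- \<gamma>) * (m n / (real n + 1))) \<longlonglongrightarrow> (- \<gamma>) * 0" by (intro tendsto_intros m)
  then have "eventual_bound (\<lambda>n. g n + (- \<gamma>) * (m n / (real n + 1))) (a + 0)"
    by (intro eventual_bound_add g eventual_bound_tendsto) simp
  then have w: "\<forall>\<^sub>F n in sequentially. g n + (- \<gamma>) * (m n / (real n + 1)) \<le> a + \<epsilon>" if "\<epsilon> > 0" for \<epsilon>
    using eventual_boundD that by simp
  have zb: "eventual_bound (\<lambda>n. z n / (real n + 1)) (a / (1 + \<gamma>))"
    unfolding eventual_bound_def
  proof (intro allI impI)
    fix \<epsilon> :: real assume \<epsilon>: "\<epsilon> > 0"
    have "\<forall>\<^sub>F n in sequentially. z n / (real n + 1) \<le> (a + \<epsilon> / 2) / (1 + \<gamma>) + \<epsilon> / 2"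
      using relaxation_bound[where z = z and w = "\<lambda>n. g n + (- \<gamma>) * (m n / (real n + 1))", OF \<gamma> z_Suc w]
        \<epsilon> by (simp add: eventual_boundD)
    then show "\<forall>\<^sub>F n in sequentially. z n / (real n + 1) \<le> a / (1 + \<gamma>) + \<epsilon>"
    proof eventually_elim
      case (elim n)
      have "\<epsilon> / 2 / (1 + \<gamma>) \<le> \<epsilon> / 2" using \<epsilon> \<gamma> by (simp add: field_simps)
      then show ?case using elim unfolding add_divide_distrib by linarith
    qed
  qed
  have "eventual_bound (\<lambda>n. z n / (real n + 1) + m n / (real n + 1)) (a / (1 + \<gamma>) + 0)"
    by (intro eventual_bound_add zb eventual_bound_tendsto m)
  moreover have "z n / (real n + 1) + m n / (real n + 1) = x n" for n
    by (simp add: z_def add_divide_distrib[symmetric])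
  ultimately show ?thesis by simp
qed

text \<open>Upper and lower limits of the coordinates form a subsolution and a supersolution of the same
  recursion. Their difference is a bounded subsolution of the homogeneous recursion and hence vanishes.\<close>

lemma noisy_system_converges:
  fixes x m e :: "nat \<Rightarrow> nat \<Rightarrow> real"
  assumes x: "\<And>d n. 0 \<le> x d n" "\<And>d n. x d n \<le> 1"
    and m: "\<And>d. (\<lambda>n. m d n / (real n + 1)) \<longlonglongrightarrow> 0"
    and e: "\<And>d. e d \<longlonglongrightarrow> 0"
    and rec: "\<And>d n. (real n + 2) * x d (Suc n) - m d (Suc n)
      = (real n + 1) * x d n - m d n - 2 * (real d + 1) * x d n
        + ((real d + 1) * ((if d = 0 then 0 else x (d - 1) n) + x (Suc d) n) + of_bool (d = 0) + e d n)"
  obtains c where "\<And>d. 0 \<le> c d" "\<And>d. c d \<le> 1" "\<And>d. x d \<longlonglongrightarrow> c d"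
    "\<And>d. (2 * real d + 3) * c d
      = (real d + 1) * ((if d = 0 then 0 else c (d - 1)) + c (Suc d)) + of_bool (d = 0)"
proof -
  let ?L = "\<lambda>c d. (real d + 1) * ((if d = 0 then 0 else c (d - 1)) + c (Suc d)) + of_bool (d = 0) :: real"
  have "\<exists>b. 0 \<le> b \<and> b \<le> 1 \<and> eventual_bound (x d) b \<and> (\<forall>B. eventual_bound (x d) B \<longrightarrow> b \<le> B)" for d
    using least_eventual_bound[of 0 "x d" 1] x by metis
  then obtain b where b: "\<And>d. 0 \<le> b d" "\<And>d. b d \<le> 1" "\<And>d. eventual_bound (x d) (b d)"
    "\<And>d B. eventual_bound (x d) B \<Longrightarrow> b d \<le> B" by metis
  have "\<exists>a. 0 \<le> a \<and> a \<le> 1 \<and> eventual_bound (\<lambda>n. - x d n) (- a)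
      \<and> (\<forall>A. eventual_bound (\<lambda>n. - x d n) (- A) \<longrightarrow> A \<le> a)" for d
  proof -
    obtain a where "- 1 \<le> a" "a \<le> 0" "eventual_bound (\<lambda>n. - x d n) a"
      "\<And>A. eventual_bound (\<lambda>n. - x d n) A \<Longrightarrow> a \<le> A"
      using least_eventual_bound[of "- 1" "\<lambda>n. - x d n" 0] x[of d] by auto
    then show ?thesis by (intro exI[of _ "- a"]) force
  qed
  then obtain a where a: "\<And>d. 0 \<le> a d" "\<And>d. a d \<le> 1" "\<And>d. eventual_bound (\<lambda>n. - x d n) (- a d)"
    "\<And>d A. eventual_bound (\<lambda>n. - x d n) (- A) \<Longrightarrow> A \<le> a d" by metis
  have upper: "(2 * real d + 3) * b d \<le> ?L b d" for d
  proof -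
    have "eventual_bound (\<lambda>n. if d = 0 then 0 else x (d - 1) n) (if d = 0 then 0 else b (d - 1))"
      using b(3) eventual_bound_tendsto[OF tendsto_const, of 0] by auto
    then have "eventual_bound (\<lambda>n. ?L (\<lambda>d. x d n) d + e d n) (?L b d + 0)"
      by (intro eventual_bound_add eventual_bound_cmult b(3) eventual_bound_tendsto[OF e]
          eventual_bound_tendsto[OF tendsto_const]) auto
    then have "eventual_bound (x d) ((?L b d + 0) / (1 + 2 * (real d + 1)))"
      by (rule noisy_relaxation_bound[where x = "x d" and m = "m d" and \<gamma> = "2 * (real d + 1)",
            rotated -1]) (simp, rule rec, rule m)
    then have "b d \<le> ?L b d / (2 * real d + 3)" using b(4)[of d] by (simp add: algebra_simps)
    then show ?thesis by (simp only: pos_le_divide_eq mult.commute)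
  qed
  have lower: "?L a d \<le> (2 * real d + 3) * a d" for d
  proof -
    have neg: "(real n + 2) * (- x d (Suc n)) - (- m d (Suc n))
      = (real n + 1) * (- x d n) - (- m d n) - 2 * (real d + 1) * (- x d n)
        + ((real d + 1) * ((if d = 0 then 0 else - x (d - 1) n) + (- x (Suc d) n))
           + (- of_bool (d = 0)) + (- e d n))" for n
      using rec[where d=d and n=n] by (cases "d = 0") (simp_all add: algebra_simps)
    have m': "(\<lambda>n. - m d n / (real n + 1)) \<longlonglongrightarrow> 0" and e': "(\<lambda>n. - e d n) \<longlonglongrightarrow> 0"
      using tendsto_minus[OF m[of d]] tendsto_minus[OF e[of d]] by simp_all
    have "eventual_bound (\<lambda>n. if d = 0 then 0 else - x (d - 1) n) (if d = 0 then 0 else - a (d - 1))"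
      using a(3) eventual_bound_tendsto[OF tendsto_const, of 0] by auto
    then have "eventual_bound (\<lambda>n. (real d + 1) * ((if d = 0 then 0 else - x (d - 1) n) + (- x (Suc d) n))
           + (- of_bool (d = 0)) + (- e d n))
        ((real d + 1) * ((if d = 0 then 0 else - a (d - 1)) + (- a (Suc d))) + (- of_bool (d = 0)) + 0)"
      by (intro eventual_bound_add eventual_bound_cmult a(3) eventual_bound_tendsto[OF e']
          eventual_bound_tendsto[OF tendsto_const]) auto
    then have "eventual_bound (\<lambda>n. - x d n) (((real d + 1) * ((if d = 0 then 0 else - a (d - 1)) + (- a (Suc d)))
        + (- of_bool (d = 0)) + 0) / (1 + 2 * (real d + 1)))"
      by (rule noisy_relaxation_bound[where x = "\<lambda>n. - x d n" and m = "\<lambda>n. - m d n"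
            and \<gamma> = "2 * (real d + 1)", rotated -1]) (simp, rule neg, rule m')
    also have "((real d + 1) * ((if d = 0 then 0 else - a (d - 1)) + (- a (Suc d)))
        + (- of_bool (d = 0)) + 0) / (1 + 2 * (real d + 1)) = - (?L a d / (2 * real d + 3))"
      by (simp add: field_simps)
    finally have "?L a d / (2 * real d + 3) \<le> a d" by (rule a(4))
    then show ?thesis by (simp only: pos_divide_le_eq mult.commute)
  qed
  have "b d - a d = 0" for d
  proof (rule bounded_subsolution_zero[of "\<lambda>d. b d - a d" 1])
    show "0 \<le> b d - a d" for d using eventual_bounds_le[OF b(3)[of d] a(3)[of d]] by simp
    show "b d - a d \<le> 1" for d using a(1)[of d] b(2)[of d] by simp
    show "(2 * real d + 3) * (b d - a d)
      \<le> (real d + 1) * ((if d = 0 then 0 else b (d - 1) - a (d - 1)) + (b (Suc d) - a (Suc d)))" for d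
      using upper[of d] lower[of d] by (auto simp: algebra_simps split: if_splits)
  qed
  then have ab: "a = b" by auto
  show ?thesis
  proof (rule that[of b])
    show "x d \<longlonglongrightarrow> b d" for d using eventual_bounds_tendsto[OF b(3)[of d] a(3)[of d, unfolded ab]] .
    show "(2 * real d + 3) * b d = ?L b d" for d
      using upper[of d] lower[of d] unfolding ab by (rule antisym)
  qed (rule b)+
qed

section \<open>A strong law of large numbers from second moments\<close>

text \<open>The series of the \<open>(Z j)\<^sup>2\<close> has finite expectation, so it converges almost surely.\<close>

lemma (in prob_space) AE_tendsto_0_of_summable_second_moments:
  fixes Z :: "nat \<Rightarrow> 'a \<Rightarrow> real"
  assumes int: "\<And>j. integrable M (\<lambda>\<omega>. (Z j \<omega>)\<^sup>2)"
    and le: "\<And>j. expectation (\<lambda>\<omega>. (Z j \<omega>)\<^sup>2) \<le> c j" and c: "summable c"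
  shows "AE \<omega> in M. (\<lambda>j. Z j \<omega>) \<longlonglongrightarrow> 0"
proof -
  have [measurable]: "(\<lambda>\<omega>. (Z j \<omega>)\<^sup>2) \<in> borel_measurable M" for j using int by simp
  have c0: "0 \<le> c j" for j by (rule order_trans[OF integral_nonneg_AE le]) simp
  have "(\<integral>\<^sup>+\<omega>. (\<Sum>j. ennreal ((Z j \<omega>)\<^sup>2)) \<partial>M) = (\<Sum>j. \<integral>\<^sup>+\<omega>. ennreal ((Z j \<omega>)\<^sup>2) \<partial>M)"
    by (intro nn_integral_suminf) measurable
  also have "\<dots> \<le> (\<Sum>j. ennreal (c j))"
  proof (intro suminf_le summableI)
    fix j
    have "(\<integral>\<^sup>+\<omega>. ennreal ((Z j \<omega>)\<^sup>2) \<partial>M) = ennreal (expectation (\<lambda>\<omega>. (Z j \<omega>)\<^sup>2))"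
      by (intro nn_integral_eq_integral int) simp
    also have "\<dots> \<le> ennreal (c j)" by (intro ennreal_leI le)
    finally show "(\<integral>\<^sup>+\<omega>. ennreal ((Z j \<omega>)\<^sup>2) \<partial>M) \<le> ennreal (c j)" .
  qed
  also have "\<dots> = ennreal (\<Sum>j. c j)" by (intro suminf_ennreal2 c0 c)
  also have "\<dots> < \<infinity>" by simp
  finally have "AE \<omega> in M. (\<Sum>j. ennreal ((Z j \<omega>)\<^sup>2)) \<noteq> \<infinity>"
    by (intro nn_integral_PInf_AE) auto
  then show ?thesis
  proof eventually_elim
    case (elim \<omega>)
    then have "summable (\<lambda>j. (Z j \<omega>)\<^sup>2)" by (intro summable_suminf_not_top) auto
    then have "(\<lambda>j. (Z j \<omega>)\<^sup>2) \<longlonglongrightarrow> 0" by (rule summable_LIMSEQ_zero)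
    then have "(\<lambda>j. sqrt ((Z j \<omega>)\<^sup>2)) \<longlonglongrightarrow> sqrt 0" by (rule tendsto_real_sqrt)
    then show ?case by (simp add: tendsto_rabs_zero_iff)
  qed
qed

text \<open>A strong law of large numbers suited to sums of orthogonal increments. Along the
  squares \<open>n = j\<^sup>2\<close> the second moments of \<open>S n / n\<close> are of order \<open>1 / j\<^sup>2\<close> and thus summable. Between
  consecutive squares there are \<open>2 j + 1\<close> increments; the second moment of the sum \<open>D j\<close> of their absolute values is of
  order \<open>j\<^sup>2\<close>, so \<open>D j / j\<^sup>2\<close> has summable second moments too. This interpolation
  takes the place of a maximal inequality.\<close>

lemma (in prob_space) slln_of_second_moments:
  fixes S :: "nat \<Rightarrow> 'a \<Rightarrow> real"
  assumes [measurable]: "\<And>n. S n \<in> borel_measurable M"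
    and int: "\<And>n. integrable M (\<lambda>\<omega>. (S n \<omega>)\<^sup>2)"
    and S: "\<And>n. expectation (\<lambda>\<omega>. (S n \<omega>)\<^sup>2) \<le> C * (real n + 1)"
    and int_inc: "\<And>n. integrable M (\<lambda>\<omega>. (S (Suc n) \<omega> - S n \<omega>)\<^sup>2)"
    and inc: "\<And>n. expectation (\<lambda>\<omega>. (S (Suc n) \<omega> - S n \<omega>)\<^sup>2) \<le> C"
  shows "AE \<omega> in M. (\<lambda>n. S n \<omega> / (real n + 1)) \<longlonglongrightarrow> 0"
proof -
  define D where "D j \<omega> = (\<Sum>k\<in>{j\<^sup>2..<(Suc j)\<^sup>2}. \<bar>S (Suc k) \<omega> - S k \<omega>\<bar>)" for j \<omega>
  have C0: "0 \<le> C" by (rule order_trans[OF integral_nonneg_AE inc[of 0]]) simp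
  have square_bound: "B / ((real j)\<^sup>2 + 1) \<le> 2 * B / (real j + 1)\<^sup>2" if "0 \<le> B" for B j
  proof -
    have "B / ((real j)\<^sup>2 + 1) = 2 * B / (2 * ((real j)\<^sup>2 + 1))"
      by (simp only: mult_divide_mult_cancel_left)
    also have "\<dots> \<le> 2 * B / (real j + 1)\<^sup>2"
    proof (intro divide_left_mono)
      show "(real j + 1)\<^sup>2 \<le> 2 * ((real j)\<^sup>2 + 1)"
        using zero_le_power2[of "real j - 1"] by (simp add: power2_eq_square algebra_simps)
    qed (use that in \<open>auto intro!: mult_pos_pos add_nonneg_pos\<close>)
    finally show ?thesis .
  qed
  have summ: "summable (\<lambda>j. B / (real j + 1)\<^sup>2)" for B :: real
    using summable_mult[OF inverse_squares_sums[THEN sums_summable], of B] by (simp add: add.commute)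
  have "AE \<omega> in M. (\<lambda>j. S (j\<^sup>2) \<omega> / ((real j)\<^sup>2 + 1)) \<longlonglongrightarrow> 0"
  proof (rule AE_tendsto_0_of_summable_second_moments)
    show "integrable M (\<lambda>\<omega>. (S (j\<^sup>2) \<omega> / ((real j)\<^sup>2 + 1))\<^sup>2)" for j
      unfolding power_divide by (intro integrable_divide int)
    show "expectation (\<lambda>\<omega>. (S (j\<^sup>2) \<omega> / ((real j)\<^sup>2 + 1))\<^sup>2) \<le> 2 * C / (real j + 1)\<^sup>2" for j
    proof -
      have "expectation (\<lambda>\<omega>. (S (j\<^sup>2) \<omega> / ((real j)\<^sup>2 + 1))\<^sup>2)
        \<le> C * ((real j)\<^sup>2 + 1) / ((real j)\<^sup>2 + 1)\<^sup>2"
        unfolding power_divide using S[of "j\<^sup>2"] by (simp add: divide_right_mono)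
      also have "\<dots> = C / ((real j)\<^sup>2 + 1)" by (simp add: power2_eq_square)
      also have "\<dots> \<le> 2 * C / (real j + 1)\<^sup>2" by (rule square_bound[OF C0])
      finally show ?thesis .
    qed
  qed (rule summ)
  moreover have "AE \<omega> in M. (\<lambda>j. D j \<omega> / ((real j)\<^sup>2 + 1)) \<longlonglongrightarrow> 0"
  proof (rule AE_tendsto_0_of_summable_second_moments)
    have D_le: "(D j \<omega>)\<^sup>2 \<le> (2 * real j + 1) * (\<Sum>k\<in>{j\<^sup>2..<(Suc j)\<^sup>2}. (S (Suc k) \<omega> - S k \<omega>)\<^sup>2)" for j \<omega>
    proof -
      have "(D j \<omega>)\<^sup>2 \<le> (\<Sum>k\<in>{j\<^sup>2..<(Suc j)\<^sup>2}. 1\<^sup>2) * (\<Sum>k\<in>{j\<^sup>2..<(Suc j)\<^sup>2}. \<bar>S (Suc k) \<omega> - S k \<omega>\<bar>\<^sup>2)"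
        using Cauchy_Schwarz_ineq_sum[of "\<lambda>_. 1" "\<lambda>k. \<bar>S (Suc k) \<omega> - S k \<omega>\<bar>" "{j\<^sup>2..<(Suc j)\<^sup>2}"]
        by (simp add: D_def)
      also have "(\<Sum>k\<in>{j\<^sup>2..<(Suc j)\<^sup>2}. 1\<^sup>2 :: real) = 2 * real j + 1"
        by (simp add: power2_eq_square)
      finally show ?thesis by simp
    qed
    have int_R: "integrable M (\<lambda>\<omega>. (2 * real j + 1) * (\<Sum>k\<in>{j\<^sup>2..<(Suc j)\<^sup>2}. (S (Suc k) \<omega> - S k \<omega>)\<^sup>2))" for j
      by (intro integrable_mult_right Bochner_Integration.integrable_sum int_inc)
    have int_D: "integrable M (\<lambda>\<omega>. (D j \<omega>)\<^sup>2)" for j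
      by (rule Bochner_Integration.integrable_bound[OF int_R[of j]])
         (auto simp: D_def[symmetric] intro!: AE_I2 order_trans[OF D_le] simp flip: D_def,
          unfold D_def, measurable)
    show "integrable M (\<lambda>\<omega>. (D j \<omega> / ((real j)\<^sup>2 + 1))\<^sup>2)" for j
      unfolding power_divide by (intro integrable_divide int_D)
    show "expectation (\<lambda>\<omega>. (D j \<omega> / ((real j)\<^sup>2 + 1))\<^sup>2) \<le> 16 * C / (real j + 1)\<^sup>2" for j
    proof -
      have "expectation (\<lambda>\<omega>. (D j \<omega>)\<^sup>2)
        \<le> expectation (\<lambda>\<omega>. (2 * real j + 1) * (\<Sum>k\<in>{j\<^sup>2..<(Suc j)\<^sup>2}. (S (Suc k) \<omega> - S k \<omega>)\<^sup>2))"
        by (intro integral_mono int_D int_R D_le)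
      also have "\<dots> = (2 * real j + 1) * (\<Sum>k\<in>{j\<^sup>2..<(Suc j)\<^sup>2}. expectation (\<lambda>\<omega>. (S (Suc k) \<omega> - S k \<omega>)\<^sup>2))"
        by (simp add: Bochner_Integration.integral_sum int_inc)
      also have "\<dots> \<le> (2 * real j + 1) * (\<Sum>k\<in>{j\<^sup>2..<(Suc j)\<^sup>2}. C)"
        by (intro mult_left_mono sum_mono inc) auto
      also have "(\<Sum>k\<in>{j\<^sup>2..<(Suc j)\<^sup>2}. C) = (2 * real j + 1) * C"
        by (simp add: power2_eq_square)
      finally have "expectation (\<lambda>\<omega>. (D j \<omega> / ((real j)\<^sup>2 + 1))\<^sup>2)
        \<le> (2 * real j + 1) * ((2 * real j + 1) * C) / ((real j)\<^sup>2 + 1)\<^sup>2"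
        unfolding power_divide by (simp add: divide_right_mono)
      also have "\<dots> \<le> 8 * C * ((real j)\<^sup>2 + 1) / ((real j)\<^sup>2 + 1)\<^sup>2"
      proof (intro divide_right_mono)
        have "(2 * real j + 1) * (2 * real j + 1) \<le> 8 * ((real j)\<^sup>2 + 1)"
          using zero_le_power2[of "2 * real j - 1"] by (simp add: power2_eq_square algebra_simps)
        from mult_right_mono[OF this C0]
        show "(2 * real j + 1) * ((2 * real j + 1) * C) \<le> 8 * C * ((real j)\<^sup>2 + 1)"
          by (simp only: mult_ac)
      qed simp
      also have "\<dots> = 8 * C / ((real j)\<^sup>2 + 1)" by (simp add: power2_eq_square)
      also have "\<dots> \<le> 2 * (8 * C) / (real j + 1)\<^sup>2" by (rule square_bound) (use C0 in simp)
      also have "2 * (8 * C) / (real j + 1)\<^sup>2 = 16 * C / (real j + 1)\<^sup>2" by simp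
      finally show ?thesis .
    qed
  qed (rule summ)
  ultimately show ?thesis
  proof eventually_elim
    case (elim \<omega>)
    \<comment> \<open>the square \<open>(?q n)\<^sup>2\<close> is the last one that does not exceed \<open>n\<close>\<close>
    let ?q = "\<lambda>n. nat \<lfloor>sqrt (real n)\<rfloor>"
    have q: "(?q n)\<^sup>2 \<le> n" "n < (Suc (?q n))\<^sup>2" for n
    proof -
      have "real (?q n) \<le> sqrt (real n)" by simp
      then have "(real (?q n))\<^sup>2 \<le> (sqrt (real n))\<^sup>2" by (intro power_mono) auto
      then have "real ((?q n)\<^sup>2) \<le> real n" by simp
      then show "(?q n)\<^sup>2 \<le> n" by (simp only: of_nat_le_iff)
      have "sqrt (real n) < real (Suc (?q n))" by linarith
      then have "(sqrt (real n))\<^sup>2 < (real (Suc (?q n)))\<^sup>2" by (intro power_strict_mono) auto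
      then have "real n < real ((Suc (?q n))\<^sup>2)" by simp
      then show "n < (Suc (?q n))\<^sup>2" by (simp only: of_nat_less_iff)
    qed
    have q_top: "filterlim ?q at_top sequentially"
      by (intro filterlim_compose[OF filterlim_nat_sequentially]
          filterlim_compose[OF filterlim_floor_sequentially]
          filterlim_compose[OF sqrt_at_top] filterlim_real_sequentially)
    let ?b = "\<lambda>j. \<bar>S (j\<^sup>2) \<omega> / ((real j)\<^sup>2 + 1)\<bar> + D j \<omega> / ((real j)\<^sup>2 + 1)"
    have bound: "\<bar>S n \<omega> / (real n + 1)\<bar> \<le> ?b (?q n)" for n
    proof -
      define j where "j = ?q n"
      note j = q[of n, folded j_def]
      have "S n \<omega> - S (j\<^sup>2) \<omega> = (\<Sum>k\<in>{j\<^sup>2..<n}. S (Suc k) \<omega> - S k \<omega>)"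
        using sum_Suc_diff'[OF j(1), of "\<lambda>k. S k \<omega>"] by simp
      also have "\<bar>\<dots>\<bar> \<le> (\<Sum>k\<in>{j\<^sup>2..<n}. \<bar>S (Suc k) \<omega> - S k \<omega>\<bar>)" by (rule sum_abs)
      also have "\<dots> \<le> D j \<omega>" unfolding D_def using j by (intro sum_mono2) auto
      finally have le: "\<bar>S n \<omega>\<bar> \<le> \<bar>S (j\<^sup>2) \<omega>\<bar> + D j \<omega>" by linarith
      have j1: "(real j)\<^sup>2 \<le> real n" using j(1) by (metis of_nat_le_iff of_nat_power)
      have "\<bar>S n \<omega> / (real n + 1)\<bar> \<le> (\<bar>S (j\<^sup>2) \<omega>\<bar> + D j \<omega>) / (real n + 1)"
        unfolding abs_divide using le by (simp add: divide_right_mono)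
      also have "\<dots> \<le> (\<bar>S (j\<^sup>2) \<omega>\<bar> + D j \<omega>) / ((real j)\<^sup>2 + 1)"
        using j1 le by (intro divide_left_mono mult_pos_pos) (auto intro!: add_nonneg_pos)
      finally show ?thesis by (simp add: j_def add_divide_distrib)
    qed
    have "?b \<longlonglongrightarrow> 0 + 0" using elim by (intro tendsto_add tendsto_rabs_zero)
    then have "(\<lambda>n. ?b (?q n)) \<longlonglongrightarrow> 0" using filterlim_compose[OF _ q_top] by fastforce
    then have "(\<lambda>n. \<bar>S n \<omega> / (real n + 1)\<bar>) \<longlonglongrightarrow> 0"
      by (rule Lim_null_comparison[rotated]) (use bound in auto)
    then show ?case by (rule tendsto_rabs_zero_cancel)
  qed
qed

section \<open>One step of the process on a fixed graph\<close>

definition step_edges :: "nat \<Rightarrow> nat \<Rightarrow> nat \<Rightarrow> nat set set \<Rightarrow> nat set set" where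
  "step_edges n a b E = delete_edges (Suc n) b (duplicate (Suc n) a E)"

definition graph_on :: "nat \<Rightarrow> nat set set \<Rightarrow> bool" where
  "graph_on n E \<longleftrightarrow> (\<forall>e\<in>E. e \<subseteq> {..n} \<and> card e = 2)"

definition degree_stat :: "(nat \<Rightarrow> real) \<Rightarrow> nat \<Rightarrow> nat set set \<Rightarrow> real" where
  "degree_stat \<phi> n E = (\<Sum>x\<le>n. \<phi> (degree E x))"

definition choice_mean :: "nat \<Rightarrow> (nat \<Rightarrow> nat \<Rightarrow> real) \<Rightarrow> real" where
  "choice_mean n g = (\<Sum>a\<le>n. \<Sum>b\<le>n. g a b) / (real n + 1)\<^sup>2"

text \<open>The expected contribution, after the next step, of a vertex that now has degree \<open>k\<close> to a sum of \<open>\<phi>\<close>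
  over all degrees. The first line is the case that the vertex is stripped, the second that one of its \<open>K - 1\<close>
  neighbours is stripped, the third that neither happens; within each, \<open>K\<close> of the \<open>N\<close> choices of the duplicated
  vertex add an edge. The last line credits the new vertex to the vertex that it
  copies. For \<open>k = 0\<close> the truncated \<open>k - 1\<close> is harmless, since its coefficient vanishes.\<close>

definition transition :: "nat \<Rightarrow> (nat \<Rightarrow> real) \<Rightarrow> nat \<Rightarrow> real" where
  "transition n \<phi> k = (let N = real n + 1; K = real k + 1 in
     ((N - K) * \<phi> 0 + K * \<phi> 1
      + (K - 1) * (K * \<phi> k + (N - K) * \<phi> (k - 1))
      + (N - K) * (K * \<phi> (k + 1) + (N - K) * \<phi> k)
      + N * \<phi> (k + 1)) / N\<^sup>2)"

lemma neighbours_sym: "y \<in> neighbours E x \<longleftrightarrow> x \<in> neighbours E y"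
  by (simp add: neighbours_def insert_commute)

lemma neighbours_graph_on:
  assumes "graph_on n E"
  shows "neighbours E x \<subseteq> {..n} - {x}" "finite (neighbours E x)"
proof -
  have "y \<le> n \<and> y \<noteq> x" if "{x, y} \<in> E" for y
    using assms that by (force simp: graph_on_def)
  then show *: "neighbours E x \<subseteq> {..n} - {x}" by (auto simp: neighbours_def)
  then show "finite (neighbours E x)" by (rule finite_subset) simp
qed

lemma neighbours_graph_on_new:
  assumes "graph_on n E"
  shows "neighbours E (Suc n) = {}"
  using assms by (force simp: graph_on_def neighbours_def)

lemma neighbours_step_edges_new:
  assumes "graph_on n E" "a \<le> n"
  shows "neighbours (step_edges n a b E) (Suc n) = insert a (neighbours E a)"
  using neighbours_graph_on_new[OF assms(1)] neighbours_graph_on[OF assms(1)] assms(2)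
  by (force simp: step_edges_def delete_edges_def duplicate_def neighbours_def doubleton_eq_iff)

lemma neighbours_step_edges_old:
  assumes "graph_on n E" "a \<le> n" "x \<le> n"
  shows "neighbours (step_edges n a b E) x
    = (if x = b then {} else neighbours E x - {b})
      \<union> (if a \<in> insert x (neighbours E x) then {Suc n} else {})"
proof -
  have [simp]: "{Suc n, y} \<notin> E" "{y, Suc n} \<notin> E" for y
    using assms(1) by (force simp: graph_on_def)+
  have 1: "{x, y} \<in> duplicate (Suc n) a E \<longleftrightarrow>
      {x, y} \<in> E \<or> (y = Suc n \<and> (x = a \<or> {a, x} \<in> E))" for y
    using assms(2,3) by (auto simp: duplicate_def neighbours_def doubleton_eq_iff)
  have "{x, y} \<in> step_edges n a b E \<longleftrightarrow>
      (if x = b then False else y \<noteq> b \<and> {x, y} \<in> E) \<or> (y = Suc n \<and> (a = x \<or> {x, a} \<in> E))" for y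
    using assms(2,3) unfolding step_edges_def delete_edges_def Diff_iff mem_Collect_eq 1
    by (auto simp: insert_commute[of x a])
  then show ?thesis by (auto simp: neighbours_def)
qed

lemma degree_step_edges_new:
  assumes "graph_on n E" "a \<le> n"
  shows "degree (step_edges n a b E) (Suc n) = degree E a + 1"
  using neighbours_graph_on[OF assms(1), of a]
  by (auto simp: degree_def neighbours_step_edges_new[OF assms] card_insert_if)

lemma degree_step_edges_old:
  assumes "graph_on n E" "a \<le> n" "x \<le> n"
  shows "degree (step_edges n a b E) x
    = (if b = x then 0 else if b \<in> neighbours E x then degree E x - 1 else degree E x)
      + (if a \<in> insert x (neighbours E x) then 1 else 0)"
proof -
  note nb = neighbours_graph_on[OF assms(1), of x]
  have "Suc n \<notin> neighbours E x" using nb by auto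
  then show ?thesis
    using nb by (auto simp: degree_def neighbours_step_edges_old[OF assms])
qed

lemma sum_if_subset:
  fixes p q :: real
  assumes "finite B" "A \<subseteq> B"
  shows "(\<Sum>x\<in>B. if x \<in> A then p else q) = real (card A) * p + (real (card B) - real (card A)) * q"
proof -
  have "(\<Sum>x\<in>B. if x \<in> A then p else q) = (\<Sum>x\<in>A. p) + (\<Sum>x\<in>B - A. q)"
    using assms by (subst sum.If_cases) (auto simp: Int_absorb1 Diff_eq Collect_mem_eq Compl_eq)
  also have "real (card (B - A)) = real (card B) - real (card A)"
    using assms by (simp add: card_Diff_subset finite_subset card_mono)
  ultimately show ?thesis by simp
qed

text \<open>The degree of \<open>x\<close> after the step splits into a part determined by \<open>b\<close> and an extra \<open>1\<close> determined by
  \<open>a\<close>. The two sums can therefore be evaluated one after the other, counting \<open>K\<close> choices of \<open>a\<close> in the closed neighbourhood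
  of \<open>x\<close>, and then the choices of \<open>b\<close> equal to \<open>x\<close>, adjacent to \<open>x\<close>, or neither.\<close>

lemma sum_over_choices_at_vertex:
  fixes \<phi> :: "nat \<Rightarrow> real"
  assumes "graph_on n E" "x \<le> n"
  defines "N \<equiv> real n + 1" and "k \<equiv> degree E x" and "K \<equiv> real (degree E x) + 1"
  shows "(\<Sum>a\<le>n. \<Sum>b\<le>n. \<phi> (degree (step_edges n a b E) x))
    = (N - K) * \<phi> 0 + K * \<phi> 1
      + (K - 1) * (K * \<phi> k + (N - K) * \<phi> (k - 1))
      + (N - K) * (K * \<phi> (k + 1) + (N - K) * \<phi> k)"
proof -
  note nb = neighbours_graph_on[OF assms(1), of x]
  let ?C = "insert x (neighbours E x)"
  have cC: "real (card ?C) = K"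
    using nb by (auto simp: K_def degree_def card_insert_if)
  have C: "?C \<subseteq> {..n}" using nb assms(2) by auto
  have over_a: "(\<Sum>a\<le>n. \<phi> (j + (if a \<in> ?C then 1 else 0))) = K * \<phi> (j + 1) + (N - K) * \<phi> j" for j
  proof -
    have "(\<Sum>a\<le>n. \<phi> (j + (if a \<in> ?C then 1 else 0))) = (\<Sum>a\<le>n. if a \<in> ?C then \<phi> (j + 1) else \<phi> j)"
      by (rule sum.cong) auto
    also have "\<dots> = K * \<phi> (j + 1) + (N - K) * \<phi> j"
      by (subst sum_if_subset[OF _ C]) (simp_all add: cC[unfolded K_def] N_def K_def)
    finally show ?thesis .
  qed
  \<comment> \<open>sum over \<open>a\<close> when the choice of \<open>b\<close> has left \<open>x\<close> with degree \<open>j\<close>\<close>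
  define g where "g j = K * \<phi> (j + 1) + (N - K) * \<phi> j" for j
  have "(\<Sum>a\<le>n. \<Sum>b\<le>n. \<phi> (degree (step_edges n a b E) x))
    = (\<Sum>b\<le>n. \<Sum>a\<le>n. \<phi> (degree (step_edges n a b E) x))"
    by (rule sum.swap)
  also have "\<dots> = (\<Sum>b\<le>n. g (if b = x then 0 else if b \<in> neighbours E x then k - 1 else k))"
    unfolding g_def over_a[symmetric] k_def
    by (intro sum.cong refl) (simp only: degree_step_edges_old[OF assms(1) _ assms(2)] atMost_iff)
  also have "\<dots> = g 0 + (\<Sum>b\<in>{..n} - {x}. g (if b = x then 0 else if b \<in> neighbours E x then k - 1 else k))"
    using assms(2) by (subst sum.remove[of _ x]) auto
  also have "(\<Sum>b\<in>{..n} - {x}. g (if b = x then 0 else if b \<in> neighbours E x then k - 1 else k))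
    = (\<Sum>b\<in>{..n} - {x}. if b \<in> neighbours E x then g (k - 1) else g k)"
    by (rule sum.cong) auto
  also have "\<dots> = (K - 1) * g (k - 1) + (N - K) * g k"
    using assms(2) by (subst sum_if_subset[OF _ nb(1)]) (auto simp: N_def K_def degree_def)
  also have "(K - 1) * g (k - 1) = (K - 1) * (K * \<phi> k + (N - K) * \<phi> (k - 1))"
    by (cases "k = 0") (auto simp: g_def K_def k_def)
  finally show ?thesis by (simp add: g_def)
qed

text \<open>The growth of the degree moments and the drift of the degree counts are instances of this exact
  formula, for \<open>\<phi>\<close> linear, quadratic, or the indicator of one degree.\<close>

lemma choice_mean_degree_stat:
  assumes "graph_on n E"
  shows "choice_mean n (\<lambda>a b. degree_stat \<phi> (Suc n) (step_edges n a b E))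
    = degree_stat (transition n \<phi>) n E"
proof -
  let ?N = "real n + 1"
  have "(\<Sum>a\<le>n. \<Sum>b\<le>n. degree_stat \<phi> (Suc n) (step_edges n a b E))
    = (\<Sum>a\<le>n. \<Sum>b\<le>n. \<Sum>x\<le>n. \<phi> (degree (step_edges n a b E) x))
      + (\<Sum>a\<le>n. \<Sum>b\<le>n. \<phi> (degree E a + 1))"
    unfolding degree_stat_def sum.distrib[symmetric]
    by (intro sum.cong refl) (simp add: degree_step_edges_new[OF assms])
  also have "(\<Sum>a\<le>n. \<Sum>b\<le>n. \<Sum>x\<le>n. \<phi> (degree (step_edges n a b E) x))
    = (\<Sum>a\<le>n. \<Sum>x\<le>n. \<Sum>b\<le>n. \<phi> (degree (step_edges n a b E) x))"
    by (intro sum.cong refl sum.swap)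
  also have "\<dots> = (\<Sum>x\<le>n. \<Sum>a\<le>n. \<Sum>b\<le>n. \<phi> (degree (step_edges n a b E) x))"
    by (rule sum.swap)
  also have "(\<Sum>a\<le>n. \<Sum>b\<le>n. \<phi> (degree E a + 1)) = (\<Sum>x\<le>n. ?N * \<phi> (degree E x + 1))"
    by (simp add: add.commute)
  also have "(\<Sum>x\<le>n. \<Sum>a\<le>n. \<Sum>b\<le>n. \<phi> (degree (step_edges n a b E) x)) + \<dots>
    = (\<Sum>x\<le>n. transition n \<phi> (degree E x) * ?N\<^sup>2)"
    unfolding sum.distrib[symmetric]
    by (intro sum.cong refl, subst sum_over_choices_at_vertex[OF assms])
       (auto simp: transition_def Let_def)
  finally show ?thesis
    by (simp add: choice_mean_def degree_stat_def sum_distrib_right[symmetric])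
qed

lemma degree_stat_add:
  "degree_stat (\<lambda>k. \<phi> k + \<psi> k) n E = degree_stat \<phi> n E + degree_stat \<psi> n E"
  by (simp add: degree_stat_def sum.distrib)

lemma degree_stat_cmult:
  "degree_stat (\<lambda>k. c * \<phi> k) n E = c * degree_stat \<phi> n E"
  by (simp add: degree_stat_def sum_distrib_left)

lemma degree_stat_const: "degree_stat (\<lambda>_. c) n E = (real n + 1) * c"
  by (simp add: degree_stat_def)

lemma degree_stat_mono:
  "(\<And>k. \<phi> k \<le> \<psi> k) \<Longrightarrow> degree_stat \<phi> n E \<le> degree_stat \<psi> n E"
  by (simp add: degree_stat_def sum_mono)

text \<open>The natural parameter is the size \<open>K\<close> of the closed neighbourhood, in which the transition
  formula is polynomial for polynomial \<open>f\<close>.\<close>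

lemma transition_shift:
  fixes f :: "real \<Rightarrow> real" and n k :: nat
  defines "N \<equiv> real n + 1" and "K \<equiv> real k + 1"
  shows "transition n (\<lambda>k. f (real k + 1)) k * N\<^sup>2
    = (N - K) * f 1 + K * f 2 + (K - 1) * (K * f K + (N - K) * f (K - 1))
      + (N - K) * (K * f (K + 1) + (N - K) * f K) + N * f (K + 1)"
proof -
  have N: "N \<noteq> 0" by (simp add: N_def)
  have 1: "f (real (k + 1) + 1) = f (K + 1)" "f (real 1 + 1) = f 2" "f (real 0 + 1) = f 1"
    by (simp_all add: K_def add.commute)
  have 2: "(K - 1) * (K * f K + (N - K) * f (real (k - 1) + 1))
      = (K - 1) * (K * f K + (N - K) * f (K - 1))"
    by (cases k) (simp_all add: K_def add.commute)
  show ?thesis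
    unfolding transition_def Let_def N_def[symmetric] K_def[symmetric] 1 2 using N by simp
qed

text \<open>Duplicating and stripping balance: the sum of \<open>degree + 1\<close> increases by a constant \<open>3\<close> per step on
  average, of which \<open>1\<close> is for the new vertex and \<open>2\<close> for a mean gain of one edge.\<close>

lemma transition_linear: "transition n (\<lambda>k. real k + 1) k = real k + 1 + 3 / (real n + 1)"
proof -
  define N K where "N = real n + 1" and "K = real k + 1"
  have N: "N > 0" by (simp add: N_def)
  have "transition n (\<lambda>k. real k + 1) k * N\<^sup>2 = K * N\<^sup>2 + 3 * N"
    using transition_shift[of n "\<lambda>x. x" k, folded N_def K_def]
    by (simp add: algebra_simps power2_eq_square)
  also have "\<dots> = (K + 3 / N) * N\<^sup>2"
    using N by (simp add: field_simps power2_eq_square)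
  finally show ?thesis using N by (simp add: N_def K_def)
qed

text \<open>The terms quadratic in \<open>K\<close> cancel at order \<open>1 / N\<close>. This is what keeps the mean squared
  degree bounded instead of growing polynomially.\<close>

lemma transition_square_le:
  "transition n (\<lambda>k. (real k + 1)\<^sup>2) k \<le> (real k + 1)\<^sup>2 + (6 * (real k + 1) + 1) / (real n + 1)"
proof -
  define N K where "N = real n + 1" and "K = real k + 1"
  have N: "N > 0" and K: "K \<ge> 1" by (auto simp: N_def K_def)
  have "transition n (\<lambda>k. (real k + 1)\<^sup>2) k * N\<^sup>2
    = K\<^sup>2 * N\<^sup>2 + (6 * K + 1) * N + 4 * K * (1 - K)"
    unfolding transition_shift[of n "\<lambda>x. x\<^sup>2" k, folded N_def K_def]
    by (simp add: algebra_simps power2_eq_square)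
  also have "\<dots> \<le> K\<^sup>2 * N\<^sup>2 + (6 * K + 1) * N"
    using K by (simp add: mult_nonneg_nonpos)
  also have "\<dots> = (K\<^sup>2 + (6 * K + 1) / N) * N\<^sup>2"
    using N by (simp add: field_simps power2_eq_square)
  finally have "transition n (\<lambda>k. (real k + 1)\<^sup>2) k \<le> K\<^sup>2 + (6 * K + 1) / N"
    using N by (simp add: mult_le_cancel_right)
  then show ?thesis by (simp add: N_def K_def)
qed

text \<open>The error, multiplied by \<open>N\<^sup>2\<close>, is the expression \<open>R\<close> below. Its part near \<open>k = d\<close>, from
  two simultaneous changes at one vertex, is bounded in terms of \<open>d\<close>; the part \<open>\<plusminus>K\<close>, present for \<open>d \<le> 1\<close> only, comes from
  stripped vertices that keep the edge to the new vertex and is not bounded, whence the summand \<open>K\<close>.\<close>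

lemma transition_indicator:
  fixes n d k :: nat
  defines "N \<equiv> real n + 1" and "K \<equiv> real k + 1"
  shows "\<bar>transition n (\<lambda>j. of_bool (j = d)) k
      - ((1 - 2 * (real d + 1) / N) * of_bool (k = d)
         + (real d + 1) / N * (of_bool (k + 1 = d) + of_bool (k = d + 1)) + of_bool (d = 0) / N)\<bar>
    \<le> (2 * (real d + 2)\<^sup>2 + K) / N\<^sup>2" (is "\<bar>?T - ?t\<bar> \<le> _")
proof -
  have N: "N > 0" and K: "K \<ge> 1" by (auto simp: N_def K_def)
  define R where "R = (if k = d then K * (K - 1) + K\<^sup>2 else if k = d + 1 then - (K * (K - 1))
    else if k + 1 = d then - (K\<^sup>2) else 0) + (if d = 0 then - K else if d = 1 then K else 0)"
  have 1: "?T * N\<^sup>2 = (N - K) * of_bool (d = 0) + K * of_bool (d = 1)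
      + (K - 1) * (K * of_bool (k = d) + (N - K) * of_bool (k = d + 1))
      + (N - K) * (K * of_bool (k + 1 = d) + (N - K) * of_bool (k = d)) + N * of_bool (k + 1 = d)"
  proof -
    have a: "of_bool (0 = d) = (of_bool (d = 0) :: real)" "of_bool (1 = d) = (of_bool (d = 1) :: real)"
      by (auto simp: of_bool_def)
    have e: "x / N\<^sup>2 * N\<^sup>2 = x" for x using N by simp
    have b: "(K - 1) * (K * of_bool (k = d) + (N - K) * of_bool (k - 1 = d))
      = (K - 1) * (K * of_bool (k = d) + (N - K) * of_bool (k = d + 1))"
      by (cases k) (simp_all add: K_def)
    show ?thesis
      unfolding transition_def Let_def N_def[symmetric] K_def[symmetric] a b by (rule e)
  qed
  have 2: "?t * N\<^sup>2 = (N\<^sup>2 - 2 * (real d + 1) * N) * of_bool (k = d)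
      + (real d + 1) * N * (of_bool (k + 1 = d) + of_bool (k = d + 1)) + of_bool (d = 0) * N"
    using N by (simp add: field_simps power2_eq_square)
  have "?T * N\<^sup>2 - ?t * N\<^sup>2 = R"
  proof -
    consider "k = d" | "k = d + 1" | "d = k + 1" | "k \<noteq> d" "k \<noteq> d + 1" "k + 1 \<noteq> d" by arith
    then show ?thesis
      unfolding 1 2 R_def by cases (auto simp: K_def algebra_simps power2_eq_square)
  qed
  moreover have "\<bar>R\<bar> \<le> 2 * (real d + 2)\<^sup>2 + K"
  proof -
    consider "k \<le> d + 1" "K \<le> real d + 2" | "k > d + 1" by (force simp: K_def)
    then show ?thesis
    proof cases
      case 1
      have sq: "K\<^sup>2 \<le> (real d + 2)\<^sup>2" using K 1 by (intro power_mono) auto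
      have "0 \<le> K * (K - 1)" using K by simp
      moreover have "K * (K - 1) \<le> K\<^sup>2" using K by (simp add: power2_eq_square algebra_simps)
      moreover have "\<bar>(if k = d then J + S else if k = d + 1 then - J else if k + 1 = d then - S else 0)
          + (if d = 0 then - K else if d = 1 then K else 0)\<bar> \<le> 2 * B + K"
        if "0 \<le> J" "J \<le> S" "S \<le> B" for J S B
        using that K by auto
      ultimately show ?thesis using sq unfolding R_def by blast
    next
      case 2
      then show ?thesis using K unfolding R_def by (auto simp: abs_le_iff)
    qed
  qed
  ultimately have "\<bar>(?T - ?t) * N\<^sup>2\<bar> \<le> 2 * (real d + 2)\<^sup>2 + K"
    by (simp only: left_diff_distrib)
  then show ?thesis using N by (simp add: abs_mult pos_le_divide_eq)
qed

lemma degree_stat_transition_indicator: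
  fixes n d :: nat and E :: "nat set set"
  defines "N \<equiv> real n + 1"
  shows "\<bar>degree_stat (transition n (\<lambda>j. of_bool (j = d))) n E
      - ((1 - 2 * (real d + 1) / N) * degree_stat (\<lambda>k. of_bool (k = d)) n E
         + (real d + 1) / N * (degree_stat (\<lambda>k. of_bool (k + 1 = d)) n E
             + degree_stat (\<lambda>k. of_bool (k = d + 1)) n E) + of_bool (d = 0))\<bar>
    \<le> 2 * (real d + 2)\<^sup>2 / N + degree_stat (\<lambda>k. real k + 1) n E / N\<^sup>2"
proof -
  have N: "N > 0" by (simp add: N_def)
  define t where "t k = (1 - 2 * (real d + 1) / N) * of_bool (k = d)
         + (real d + 1) / N * (of_bool (k + 1 = d) + of_bool (k = d + 1)) + of_bool (d = 0) / N" for k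
  have t: "degree_stat t n E = (1 - 2 * (real d + 1) / N) * degree_stat (\<lambda>k. of_bool (k = d)) n E
         + (real d + 1) / N * (degree_stat (\<lambda>k. of_bool (k + 1 = d)) n E
             + degree_stat (\<lambda>k. of_bool (k = d + 1)) n E) + of_bool (d = 0)"
    unfolding t_def degree_stat_add degree_stat_cmult degree_stat_const N_def[symmetric]
    using N by simp
  have "\<bar>degree_stat (transition n (\<lambda>j. of_bool (j = d))) n E - degree_stat t n E\<bar>
    \<le> (\<Sum>x\<le>n. \<bar>transition n (\<lambda>j. of_bool (j = d)) (degree E x) - t (degree E x)\<bar>)"
    unfolding degree_stat_def sum_subtractf[symmetric] by (rule sum_abs)
  also have "\<dots> \<le> (\<Sum>x\<le>n. (2 * (real d + 2)\<^sup>2 + (real (degree E x) + 1)) / N\<^sup>2)"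
    unfolding t_def N_def by (intro sum_mono transition_indicator)
  also have "\<dots> = (N * (2 * (real d + 2)\<^sup>2) + degree_stat (\<lambda>k. real k + 1) n E) / N\<^sup>2"
    unfolding sum_divide_distrib[symmetric] sum.distrib degree_stat_def by (simp add: N_def)
  also have "\<dots> = 2 * (real d + 2)\<^sup>2 / N + degree_stat (\<lambda>k. real k + 1) n E / N\<^sup>2"
    using N by (simp add: add_divide_distrib power2_eq_square)
  finally show ?thesis unfolding t .
qed

text \<open>Only vertices in the closed neighbourhoods of \<open>a\<close> and \<open>b\<close> change their degree, and one
  vertex is added.\<close>

lemma degree_stat_step_edges_diff:
  assumes E: "graph_on n E" and ab: "a \<le> n" "b \<le> n" and \<phi>: "\<And>k. 0 \<le> \<phi> k" "\<And>k. \<phi> k \<le> 1"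
  shows "\<bar>degree_stat \<phi> (Suc n) (step_edges n a b E) - degree_stat \<phi> n E\<bar>
    \<le> (real (degree E a) + 1) + (real (degree E b) + 1) + 1"
proof -
  let ?E' = "step_edges n a b E"
  let ?f = "\<lambda>x. \<phi> (degree ?E' x) - \<phi> (degree E x)"
  let ?A = "insert a (neighbours E a) \<union> insert b (neighbours E b)"
  have 1: "\<bar>\<phi> j - \<phi> k\<bar> \<le> 1" for j k using \<phi>[of j] \<phi>[of k] by auto
  have A: "?A \<subseteq> {..n}" using neighbours_graph_on[OF E] ab by blast
  have "(\<Sum>x\<le>n. ?f x) = (\<Sum>x\<in>?A. ?f x)"
  proof (rule sum.mono_neutral_right[OF _ A])
    have "?f x = 0" if "x \<in> {..n} - ?A" for x
    proof -
      have "x \<le> n" "a \<notin> insert x (neighbours E x)" "b \<notin> insert x (neighbours E x)"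
        using that neighbours_sym[of x E a] neighbours_sym[of x E b] by blast+
      then show ?thesis by (simp add: degree_step_edges_old[OF E ab(1)])
    qed
    then show "\<forall>x\<in>{..n} - ?A. ?f x = 0" by blast
  qed simp
  also have "\<bar>\<dots>\<bar> \<le> (\<Sum>x\<in>?A. 1)"
    by (rule order_trans[OF sum_abs]) (intro sum_mono 1)
  also have "\<dots> = real (card ?A)" by simp
  also have "real (card ?A) \<le> real (card (insert a (neighbours E a)) + card (insert b (neighbours E b)))"
    by (intro of_nat_mono card_Un_le)
  also have "\<dots> = (real (degree E a) + 1) + (real (degree E b) + 1)"
    using neighbours_graph_on[OF E] by (auto simp: degree_def card_insert_if)
  finally have "\<bar>\<Sum>x\<le>n. ?f x\<bar> \<le> (real (degree E a) + 1) + (real (degree E b) + 1)" .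
  moreover have "degree_stat \<phi> (Suc n) ?E' - degree_stat \<phi> n E
      = (\<Sum>x\<le>n. ?f x) + \<phi> (degree ?E' (Suc n))"
    by (simp add: degree_stat_def sum_subtractf)
  ultimately show ?thesis using \<phi>[of "degree ?E' (Suc n)"] by linarith
qed

lemma choice_mean_square_diff_le:
  assumes E: "graph_on n E" and \<phi>: "\<And>k. 0 \<le> \<phi> k" "\<And>k. \<phi> k \<le> 1"
  shows "choice_mean n (\<lambda>a b. (degree_stat \<phi> (Suc n) (step_edges n a b E) - degree_stat \<phi> n E)\<^sup>2)
    \<le> 6 * degree_stat (\<lambda>k. (real k + 1)\<^sup>2) n E / (real n + 1) + 3"
proof -
  let ?N = "real n + 1" and ?K = "\<lambda>x. real (degree E x) + 1"
  let ?Q = "degree_stat (\<lambda>k. (real k + 1)\<^sup>2) n E"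
  \<comment> \<open>Cauchy-Schwarz for three summands\<close>
  have cs: "(x + y + 1)\<^sup>2 \<le> 3 * (x\<^sup>2 + y\<^sup>2 + 1)" for x y :: real
    using zero_le_power2[of "x - y"] zero_le_power2[of "x - 1"] zero_le_power2[of "y - 1"]
    by (simp add: power2_eq_square algebra_simps)
  have "(\<Sum>a\<le>n. \<Sum>b\<le>n. (degree_stat \<phi> (Suc n) (step_edges n a b E) - degree_stat \<phi> n E)\<^sup>2)
    \<le> (\<Sum>a\<le>n. \<Sum>b\<le>n. 3 * ((?K a)\<^sup>2 + (?K b)\<^sup>2 + 1))"
  proof (intro sum_mono)
    fix a b assume "a \<in> {..n}" "b \<in> {..n}"
    then have "(degree_stat \<phi> (Suc n) (step_edges n a b E) - degree_stat \<phi> n E)\<^sup>2 \<le> (?K a + ?K b + 1)\<^sup>2"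
      using degree_stat_step_edges_diff[OF E _ _ \<phi>, of a b]
      by (intro abs_le_square_iff[THEN iffD1]) (auto intro: order_trans)
    also note cs
    finally show "(degree_stat \<phi> (Suc n) (step_edges n a b E) - degree_stat \<phi> n E)\<^sup>2
      \<le> 3 * ((?K a)\<^sup>2 + (?K b)\<^sup>2 + 1)" .
  qed
  also have "\<dots> = 6 * ?N * ?Q + 3 * ?N\<^sup>2"
  proof -
    have "(\<Sum>a\<le>n. \<Sum>b\<le>n. (?K a)\<^sup>2) = ?N * ?Q"
      by (simp add: degree_stat_def sum_distrib_left[symmetric] add.commute[of 1])
    moreover have "(\<Sum>a\<le>n. \<Sum>b\<le>n. (?K b)\<^sup>2) = ?N * ?Q"
      by (simp add: degree_stat_def add.commute[of 1])
    moreover have "(\<Sum>a\<le>n. \<Sum>b\<le>n. 1 :: real) = ?N\<^sup>2"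
      by (simp add: power2_eq_square add.commute[of 1])
    ultimately show ?thesis
      unfolding sum_distrib_left[symmetric] sum.distrib by simp
  qed
  finally have "(\<Sum>a\<le>n. \<Sum>b\<le>n. (degree_stat \<phi> (Suc n) (step_edges n a b E) - degree_stat \<phi> n E)\<^sup>2)
    \<le> 6 * ?N * ?Q + 3 * ?N\<^sup>2" .
  also have "6 * ?N * ?Q + 3 * ?N\<^sup>2 = (6 * ?Q / ?N + 3) * ?N\<^sup>2"
    by (simp add: divide_simps power2_eq_square) (simp add: algebra_simps)
  finally show ?thesis by (simp add: choice_mean_def pos_divide_le_eq)
qed

lemma choice_mean_const: "choice_mean n (\<lambda>_ _. c) = c"
  by (simp add: choice_mean_def power2_eq_square add.commute[of 1])

lemma choice_mean_add:
  "choice_mean n (\<lambda>a b. f a b + g a b) = choice_mean n f + choice_mean n g"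
  by (simp add: choice_mean_def sum.distrib add_divide_distrib)

lemma choice_mean_cmult: "choice_mean n (\<lambda>a b. c * f a b) = c * choice_mean n f"
  by (simp add: choice_mean_def sum_distrib_left)

text \<open>This is the variance bound: the mean of \<open>(m + D - h)\<^sup>2\<close>, with \<open>h\<close> the mean of \<open>D\<close>, is \<open>m\<^sup>2\<close> plus the
  variance of \<open>D\<close>.\<close>

lemma choice_mean_square_centred:
  "choice_mean n (\<lambda>a b. (m + D a b - choice_mean n D)\<^sup>2) \<le> m\<^sup>2 + choice_mean n (\<lambda>a b. (D a b)\<^sup>2)"
proof -
  define h where "h = choice_mean n D"
  have "(\<lambda>a b. (m + D a b - h)\<^sup>2) = (\<lambda>a b. (D a b)\<^sup>2 + (2 * (m - h) * D a b + (m - h)\<^sup>2))"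
    by (simp add: fun_eq_iff power2_eq_square algebra_simps)
  then have "choice_mean n (\<lambda>a b. (m + D a b - h)\<^sup>2)
    = choice_mean n (\<lambda>a b. (D a b)\<^sup>2) + (2 * (m - h) * h + (m - h)\<^sup>2)"
    by (simp only: choice_mean_add choice_mean_cmult choice_mean_const h_def[symmetric])
  also have "2 * (m - h) * h + (m - h)\<^sup>2 = m\<^sup>2 - h\<^sup>2" by (simp add: power2_eq_square algebra_simps)
  finally show ?thesis unfolding h_def by simp
qed

section \<open>Averaging over the choices of one step\<close>

text \<open>The observables known after \<open>n\<close> steps. They are functions of the two choice
  sequences, so that a single step can be analysed by overwriting the choices at position \<open>n\<close>.\<close>

definition depends_below :: "nat \<Rightarrow> ((nat \<Rightarrow> nat) \<Rightarrow> (nat \<Rightarrow> nat) \<Rightarrow> 'b) \<Rightarrow> bool" where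
  "depends_below n F \<longleftrightarrow>
    (\<forall>u v u' v'. (\<forall>i<n. u i = u' i \<and> v i = v' i) \<longrightarrow> F u v = F u' v')"

lemma depends_belowI:
  "(\<And>u v u' v'. (\<And>i. i < n \<Longrightarrow> u i = u' i) \<Longrightarrow> (\<And>i. i < n \<Longrightarrow> v i = v' i) \<Longrightarrow> F u v = F u' v')
    \<Longrightarrow> depends_below n F"
  unfolding depends_below_def by blast

lemma depends_belowD:
  "depends_below n F \<Longrightarrow> (\<And>i. i < n \<Longrightarrow> u i = u' i) \<Longrightarrow> (\<And>i. i < n \<Longrightarrow> v i = v' i) \<Longrightarrow> F u v = F u' v'"
  unfolding depends_below_def by blast

lemma depends_below_mono: "depends_below m F \<Longrightarrow> m \<le> n \<Longrightarrow> depends_below n F"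
  unfolding depends_below_def by (meson less_le_trans)

lemma depends_below_comp2:
  assumes "depends_below n F" "depends_below n G"
  shows "depends_below n (\<lambda>u v. f (F u v) (G u v))"
proof (rule depends_belowI)
  fix u v u' v' :: "nat \<Rightarrow> nat"
  assume uv: "\<And>i. i < n \<Longrightarrow> u i = u' i" "\<And>i. i < n \<Longrightarrow> v i = v' i"
  show "f (F u v) (G u v) = f (F u' v') (G u' v')"
    by (simp only: depends_belowD[OF assms(1) uv] depends_belowD[OF assms(2) uv])
qed

lemma depends_below_comp: "depends_below n F \<Longrightarrow> depends_below n (\<lambda>u v. f (F u v))"
  by (rule depends_below_comp2[where f = "\<lambda>x y. f x"])

lemma depends_below_sum:
  "(\<And>k. k \<in> A \<Longrightarrow> depends_below n (F k)) \<Longrightarrow> depends_below n (\<lambda>u v. \<Sum>k\<in>A. F k u v)"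
  unfolding depends_below_def by (intro allI impI sum.cong refl) blast

lemma depends_below_upd:
  assumes "depends_below (Suc n) F"
  shows "depends_below n (\<lambda>u v. F (u(n := a)) (v(n := b)))"
  by (intro depends_belowI depends_belowD[OF assms]) (auto simp: less_Suc_eq)

lemma depends_below_process_edges: "depends_below n (\<lambda>u v. process_edges u v n)"
proof (induction n)
  case (Suc n)
  show ?case
  proof (rule depends_belowI)
    fix u v u' v' :: "nat \<Rightarrow> nat"
    assume "\<And>i. i < Suc n \<Longrightarrow> u i = u' i" "\<And>i. i < Suc n \<Longrightarrow> v i = v' i"
    then show "process_edges u v (Suc n) = process_edges u' v' (Suc n)"
      using depends_belowD[OF Suc, of u u' v v'] by simp
  qed
qed (simp add: depends_below_def)

lemma process_edges_upd:
  "process_edges (u(n := a)) (v(n := b)) n = process_edges u v n"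
  by (rule depends_belowD[OF depends_below_process_edges]) auto

lemma process_edges_upd_Suc:
  "process_edges (u(n := a)) (v(n := b)) (Suc n) = step_edges n a b (process_edges u v n)"
  by (simp add: process_edges_upd step_edges_def)

lemma measurable_map_count_space:
  fixes f :: "'i \<Rightarrow> 'a \<Rightarrow> 'b::countable"
  assumes "\<And>i. i \<in> set is \<Longrightarrow> f i \<in> measurable N (count_space UNIV)"
  shows "(\<lambda>x. map (\<lambda>i. f i x) is) \<in> measurable N (count_space UNIV)"
  using assms
proof (induction "is")
  case (Cons i "is")
  then have head: "f i \<in> measurable N (count_space UNIV)"
    and tail: "(\<lambda>x. map (\<lambda>i. f i x) is) \<in> measurable N (count_space UNIV)" by auto
  have "(\<lambda>x. f i x # l) \<in> measurable N (count_space UNIV)" for l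
    by (rule measurable_compose[OF head]) simp
  from measurable_compose_countable[OF this tail]
  show ?case by simp
qed simp

text \<open>The indices of the choices made in the first \<open>n\<close> steps, as a list: the choices themselves then form a
  random element of the countable type of lists, so that every function of them is measurable.\<close>

definition history_index :: "nat \<Rightarrow> (nat + nat) list" where
  "history_index n = map Inl [0..<n] @ map Inr [0..<n]"

lemma set_history_index: "set (history_index n) = Inl ` {..<n} \<union> Inr ` {..<n}"
  by (auto simp: history_index_def)

lemma depends_below_history:
  assumes "depends_below n F"
  shows "F (\<lambda>k. f (Inl k)) (\<lambda>k. f (Inr k))
    = (\<lambda>l. F (\<lambda>i. l ! i) (\<lambda>i. l ! (n + i))) (map f (history_index n))"
  unfolding history_index_def
  by (rule depends_belowD[OF assms]) (auto simp: nth_append)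

context duplication_deletion_process
begin

abbreviation along :: "((nat \<Rightarrow> nat) \<Rightarrow> (nat \<Rightarrow> nat) \<Rightarrow> 'b) \<Rightarrow> 'a \<Rightarrow> 'b" where
  "along F \<omega> \<equiv> F (\<lambda>k. U k \<omega>) (\<lambda>k. V k \<omega>)"

lemma choice_measurable: "case_sum U V i \<in> measurable M (count_space UNIV)"
  using choices_indep by (simp add: indep_vars_def)

lemma UV_measurable[measurable]:
  "U n \<in> measurable M (count_space UNIV)" "V n \<in> measurable M (count_space UNIV)"
  using choice_measurable[of "Inl n"] choice_measurable[of "Inr n"] by simp_all

lemma measurable_along:
  fixes F :: "(nat \<Rightarrow> nat) \<Rightarrow> (nat \<Rightarrow> nat) \<Rightarrow> real"
  assumes "depends_below n F"
  shows "along F \<in> borel_measurable M"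
proof -
  let ?G = "\<lambda>l. F (\<lambda>i. l ! i) (\<lambda>i. l ! (n + i))"
  have "(\<lambda>\<omega>. ?G (map (\<lambda>i. case_sum U V i \<omega>) (history_index n))) \<in> borel_measurable M"
    by (rule measurable_compose[OF measurable_map_count_space[OF choice_measurable]]) simp
  then show ?thesis
    using depends_below_history[OF assms, of "\<lambda>i. case_sum U V i _"] by simp
qed

text \<open>Observables of the first \<open>n\<close> steps and functions of the choices of the next step depend on disjoint
  parts of the independent family.\<close>

lemma indep_history_choice:
  fixes F :: "(nat \<Rightarrow> nat) \<Rightarrow> (nat \<Rightarrow> nat) \<Rightarrow> real" and g :: "nat \<Rightarrow> nat \<Rightarrow> real"
  assumes "depends_below n F"
  shows "indep_var borel (along F) borel (\<lambda>\<omega>. g (U n \<omega>) (V n \<omega>))"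
proof -
  let ?A = "set (history_index n)" and ?J = "[Inl n, Inr n] :: (nat + nat) list"
  let ?P = "\<lambda>A. PiM A (\<lambda>_. count_space UNIV) :: ((nat + nat) \<Rightarrow> nat) measure"
  let ?G = "\<lambda>l. F (\<lambda>i. l ! i) (\<lambda>i. l ! (n + i))"
  have *: "(\<lambda>f. map (\<lambda>i. f i) is) \<in> measurable (?P (set is)) (count_space UNIV)" for "is"
    by (intro measurable_map_count_space measurable_component_singleton)
  have 1: "(\<lambda>f. ?G (map (\<lambda>i. f i) (history_index n))) \<in> borel_measurable (?P ?A)"
    by (rule measurable_compose[OF *]) simp
  have 2: "(\<lambda>f. (\<lambda>l. g (l ! 0) (l ! 1)) (map (\<lambda>i. f i) ?J)) \<in> borel_measurable (?P (set ?J))"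
    by (rule measurable_compose[OF *]) simp
  have "indep_var (?P ?A) (\<lambda>\<omega>. restrict (\<lambda>i. case_sum U V i \<omega>) ?A)
      (?P (set ?J)) (\<lambda>\<omega>. restrict (\<lambda>i. case_sum U V i \<omega>) (set ?J))"
    by (rule indep_var_restrict[OF choices_indep]) (auto simp: set_history_index)
  from indep_var_compose[OF this 1 2]
  have "indep_var borel ((\<lambda>f. ?G (map (\<lambda>i. f i) (history_index n))) \<circ> (\<lambda>\<omega>. restrict (\<lambda>i. case_sum U V i \<omega>) ?A))
      borel ((\<lambda>f. (\<lambda>l. g (l ! 0) (l ! 1)) (map (\<lambda>i. f i) ?J)) \<circ> (\<lambda>\<omega>. restrict (\<lambda>i. case_sum U V i \<omega>) (set ?J)))" .
  also have "(\<lambda>f. ?G (map (\<lambda>i. f i) (history_index n))) \<circ> (\<lambda>\<omega>. restrict (\<lambda>i. case_sum U V i \<omega>) ?A) = along F"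
  proof
    fix \<omega>
    have "map (restrict (\<lambda>i. case_sum U V i \<omega>) ?A) (history_index n)
      = map (\<lambda>i. case_sum U V i \<omega>) (history_index n)" by simp
    then show "((\<lambda>f. ?G (map (\<lambda>i. f i) (history_index n))) \<circ> (\<lambda>\<omega>. restrict (\<lambda>i. case_sum U V i \<omega>) ?A)) \<omega> = along F \<omega>"
      using depends_below_history[OF assms, of "\<lambda>i. case_sum U V i \<omega>"] by (simp only: comp_apply sum.case)
  qed
  also have "(\<lambda>f. (\<lambda>l. g (l ! 0) (l ! 1)) (map (\<lambda>i. f i) ?J)) \<circ> (\<lambda>\<omega>. restrict (\<lambda>i. case_sum U V i \<omega>) (set ?J))
    = (\<lambda>\<omega>. g (U n \<omega>) (V n \<omega>))" by (simp add: fun_eq_iff)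
  finally show ?thesis .
qed

lemma prob_choices:
  assumes "a \<le> n" "b \<le> n"
  shows "prob {\<omega> \<in> space M. U n \<omega> = a \<and> V n \<omega> = b} = 1 / (real n + 1)\<^sup>2"
proof -
  have single: "prob (W -` {a} \<inter> space M) = 1 / (real n + 1)"
    if W: "W \<in> measurable M (count_space UNIV)"
      "distr M (count_space UNIV) W = measure_pmf (pmf_of_set {..n})" and "a \<le> n"
    for W :: "'a \<Rightarrow> nat" and a
  proof -
    have "prob (W -` {a} \<inter> space M) = measure (distr M (count_space UNIV) W) {a}"
      using W(1) by (simp add: measure_distr)
    also have "\<dots> = pmf (pmf_of_set {..n}) a" by (simp add: W(2) measure_pmf_single)
    also have "\<dots> = 1 / (real n + 1)" using that(3) by (simp add: add.commute)
    finally show ?thesis .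
  qed
  let ?A = "case_sum (\<lambda>_. {a}) (\<lambda>_. {b}) :: nat + nat \<Rightarrow> nat set"
  have "{\<omega> \<in> space M. U n \<omega> = a \<and> V n \<omega> = b}
    = (\<Inter>i\<in>{Inl n, Inr n}. case_sum U V i -` ?A i \<inter> space M)" by auto
  also have "prob \<dots> = (\<Prod>i\<in>{Inl n, Inr n}. prob (case_sum U V i -` ?A i \<inter> space M))"
    by (rule indep_varsD[OF choices_indep]) auto
  also have "\<dots> = 1 / (real n + 1) * (1 / (real n + 1))"
    using single[OF UV_measurable(1) U_uniform assms(1)] single[OF UV_measurable(2) V_uniform assms(2)]
    by simp
  finally show ?thesis by (simp add: power2_eq_square)
qed

lemma AE_choices_le: "AE \<omega> in M. \<forall>k. U k \<omega> \<le> k \<and> V k \<omega> \<le> k"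
proof -
  have single: "AE \<omega> in M. W \<omega> \<le> k"
    if W: "W \<in> measurable M (count_space UNIV)"
      "distr M (count_space UNIV) W = measure_pmf (pmf_of_set {..k})" for W :: "'a \<Rightarrow> nat" and k
  proof -
    have "AE x in distr M (count_space UNIV) W. x \<le> k"
      unfolding W(2) by (simp add: AE_measure_pmf_iff)
    then show ?thesis using W(1) by (simp add: AE_distr_iff)
  qed
  show ?thesis
    unfolding AE_all_countable
    using single[OF UV_measurable(1) U_uniform] single[OF UV_measurable(2) V_uniform] by auto
qed

text \<open>Almost surely only finitely many histories of length \<open>n\<close> occur, so \<open>F\<close> is almost surely bounded.\<close>

lemma integrable_along:
  fixes F :: "(nat \<Rightarrow> nat) \<Rightarrow> (nat \<Rightarrow> nat) \<Rightarrow> real"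
  assumes F: "depends_below n F"
  shows "integrable M (along F)"
proof -
  let ?P = "PiE {..<n} (\<lambda>i. {..i})"
  have fin: "finite ?P" by (intro finite_PiE) auto
  define B where "B = (\<Sum>u\<in>?P. \<Sum>v\<in>?P. \<bar>F u v\<bar>)"
  have "AE \<omega> in M. norm (along F \<omega>) \<le> B"
    using AE_choices_le
  proof eventually_elim
    case (elim \<omega>)
    let ?u = "restrict (\<lambda>k. U k \<omega>) {..<n}" and ?v = "restrict (\<lambda>k. V k \<omega>) {..<n}"
    have mem: "?u \<in> ?P" "?v \<in> ?P" using elim by auto
    have "along F \<omega> = F ?u ?v" by (rule depends_belowD[OF F]) auto
    also have "norm (F ?u ?v) \<le> (\<Sum>v\<in>?P. \<bar>F ?u v\<bar>)"
      using member_le_sum[OF mem(2), of "\<lambda>v. \<bar>F ?u v\<bar>"] fin by simp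
    also have "\<dots> \<le> B"
      unfolding B_def using member_le_sum[OF mem(1), of "\<lambda>u. \<Sum>v\<in>?P. \<bar>F u v\<bar>"] fin
      by (simp add: sum_nonneg)
    finally show ?case .
  qed
  then show ?thesis by (rule integrable_const_bound) (rule measurable_along[OF F])
qed

lemma expectation_along_mono:
  fixes F G :: "(nat \<Rightarrow> nat) \<Rightarrow> (nat \<Rightarrow> nat) \<Rightarrow> real"
  assumes "depends_below n F" "depends_below n G"
    and "\<And>u v. (\<And>k. u k \<le> k) \<Longrightarrow> (\<And>k. v k \<le> k) \<Longrightarrow> F u v \<le> G u v"
  shows "expectation (along F) \<le> expectation (along G)"
proof (rule integral_mono_AE)
  show "AE \<omega> in M. along F \<omega> \<le> along G \<omega>"
    using AE_choices_le by eventually_elim (rule assms(3), auto)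
qed (rule integrable_along[OF assms(1)] integrable_along[OF assms(2)])+

lemma expectation_along_eq:
  fixes F G :: "(nat \<Rightarrow> nat) \<Rightarrow> (nat \<Rightarrow> nat) \<Rightarrow> real"
  assumes "depends_below n F" "depends_below n G"
    and "\<And>u v. (\<And>k. u k \<le> k) \<Longrightarrow> (\<And>k. v k \<le> k) \<Longrightarrow> F u v = G u v"
  shows "expectation (along F) = expectation (along G)"
  by (intro antisym expectation_along_mono[OF assms(1,2)] expectation_along_mono[OF assms(2,1)])
     (simp_all add: assms(3))

lemma depends_below_choice_mean:
  assumes "\<And>a b. depends_below n (F a b)"
  shows "depends_below n (\<lambda>u v. choice_mean n (\<lambda>a b. F a b u v))"
  unfolding choice_mean_def
  by (intro depends_below_comp[where f = "\<lambda>x. x / _"] depends_below_sum assms)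

text \<open>This plays the role of conditioning on the first \<open>n\<close> steps: the last pair of choices may be averaged
  out by counting, because it is uniform and independent of the past.\<close>

lemma expectation_along_average:
  fixes F :: "(nat \<Rightarrow> nat) \<Rightarrow> (nat \<Rightarrow> nat) \<Rightarrow> real"
  assumes F: "depends_below (Suc n) F"
  shows "expectation (along F)
    = expectation (along (\<lambda>u v. choice_mean n (\<lambda>a b. F (u(n := a)) (v(n := b)))))"
proof -
  let ?F = "\<lambda>a b u v. F (u(n := a)) (v(n := b))"
  let ?I = "\<lambda>a b \<omega>. of_bool (U n \<omega> = a \<and> V n \<omega> = b) :: real"
  note Fab = depends_below_upd[OF F]
  have int_F: "integrable M (along (?F a b))" for a b by (rule integrable_along[OF Fab])
  have int_I: "integrable M (?I a b)" for a b
    by (rule integrable_const_bound[of _ 1]) auto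
  have indep: "indep_var borel (along (?F a b)) borel (?I a b)" for a b
    using indep_history_choice[OF Fab, where g = "\<lambda>x y. of_bool (x = a \<and> y = b)"] .
  have I: "expectation (?I a b) = 1 / (real n + 1)\<^sup>2" if "a \<le> n" "b \<le> n" for a b
  proof -
    have "expectation (?I a b) = expectation (indicator {\<omega> \<in> space M. U n \<omega> = a \<and> V n \<omega> = b})"
      by (intro Bochner_Integration.integral_cong refl) (auto simp: indicator_def)
    also have "\<dots> = prob {\<omega> \<in> space M. U n \<omega> = a \<and> V n \<omega> = b}" by simp
    also have "\<dots> = 1 / (real n + 1)\<^sup>2" by (rule prob_choices[OF that])
    finally show ?thesis .
  qed
  have "expectation (along F) = expectation (\<lambda>\<omega>. \<Sum>a\<le>n. \<Sum>b\<le>n. along (?F a b) \<omega> * ?I a b \<omega>)"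
  proof (rule integral_cong_AE)
    show "AE \<omega> in M. along F \<omega> = (\<Sum>a\<le>n. \<Sum>b\<le>n. along (?F a b) \<omega> * ?I a b \<omega>)"
      using AE_choices_le
    proof eventually_elim
      case (elim \<omega>)
      have "(\<Sum>a\<le>n. \<Sum>b\<le>n. along (?F a b) \<omega> * ?I a b \<omega>)
        = (\<Sum>a\<le>n. if a = U n \<omega> then (\<Sum>b\<le>n. if b = V n \<omega> then along (?F a b) \<omega> else 0) else 0)"
        by (intro sum.cong refl) (auto intro!: sum.cong sum.neutral)
      also have "\<dots> = along (?F (U n \<omega>) (V n \<omega>)) \<omega>" using elim by simp
      also have "\<dots> = along F \<omega>" by (subst (1 2) fun_upd_idem) simp_all
      finally show ?case by simp
    qed
    show "along F \<in> borel_measurable M" by (rule measurable_along[OF F])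
    show "(\<lambda>\<omega>. \<Sum>a\<le>n. \<Sum>b\<le>n. along (?F a b) \<omega> * ?I a b \<omega>) \<in> borel_measurable M"
      by (intro borel_measurable_sum borel_measurable_times measurable_along[OF Fab]) measurable
  qed
  also have "\<dots> = (\<Sum>a\<le>n. \<Sum>b\<le>n. expectation (\<lambda>\<omega>. along (?F a b) \<omega> * ?I a b \<omega>))"
    by (subst Bochner_Integration.integral_sum,
        intro Bochner_Integration.integrable_sum indep_var_integrable[OF indep int_F int_I],
        intro sum.cong refl Bochner_Integration.integral_sum indep_var_integrable[OF indep int_F int_I])
  also have "\<dots> = (\<Sum>a\<le>n. \<Sum>b\<le>n. expectation (along (?F a b)) / (real n + 1)\<^sup>2)"
    by (intro sum.cong refl, subst indep_var_lebesgue_integral[OF indep int_F int_I]) (simp add: I)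
  also have "\<dots> = expectation (along (\<lambda>u v. choice_mean n (\<lambda>a b. ?F a b u v)))"
    unfolding choice_mean_def
    by (simp add: Bochner_Integration.integral_sum int_F sum_divide_distrib)
  finally show ?thesis .
qed

end

section \<open>Martingale decomposition and moments of the degrees\<close>

definition stat :: "(nat \<Rightarrow> real) \<Rightarrow> nat \<Rightarrow> (nat \<Rightarrow> nat) \<Rightarrow> (nat \<Rightarrow> nat) \<Rightarrow> real" where
  "stat \<phi> n u v = degree_stat \<phi> n (process_edges u v n)"

text \<open>For admissible choices this is the expected increment of \<open>stat\<close> given the first \<open>n\<close> steps.\<close>

definition drift :: "(nat \<Rightarrow> real) \<Rightarrow> nat \<Rightarrow> (nat \<Rightarrow> nat) \<Rightarrow> (nat \<Rightarrow> nat) \<Rightarrow> real" where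
  "drift \<phi> n u v = stat (transition n \<phi>) n u v - stat \<phi> n u v"

text \<open>The martingale part of \<open>stat\<close> in its Doob decomposition, with the initial value left in.\<close>

definition noise :: "(nat \<Rightarrow> real) \<Rightarrow> nat \<Rightarrow> (nat \<Rightarrow> nat) \<Rightarrow> (nat \<Rightarrow> nat) \<Rightarrow> real" where
  "noise \<phi> n u v = stat \<phi> n u v - (\<Sum>k<n. drift \<phi> k u v)"

lemma graph_on_process_edges: "(\<And>k. u k \<le> k) \<Longrightarrow> graph_on n (process_edges u v n)"
  using process_edges_simple[of u _ v n] by (simp add: graph_on_def)

lemma depends_below_stat: "n \<le> m \<Longrightarrow> depends_below m (stat \<phi> n)"
  using depends_below_mono[OF depends_below_comp[OF depends_below_process_edges], of n m "degree_stat \<phi> n"]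
  unfolding stat_def[abs_def] .

lemma depends_below_drift: "n \<le> m \<Longrightarrow> depends_below m (drift \<phi> n)"
  unfolding drift_def[abs_def] by (intro depends_below_comp2[where f = "(-)"] depends_below_stat)

lemma depends_below_noise: "n \<le> m \<Longrightarrow> depends_below m (noise \<phi> n)"
  unfolding noise_def[abs_def]
  by (intro depends_below_comp2[where f = "(-)"] depends_below_stat depends_below_sum depends_below_drift) auto

lemma stat_upd_Suc:
  "stat \<phi> (Suc n) (u(n := a)) (v(n := b)) = degree_stat \<phi> (Suc n) (step_edges n a b (process_edges u v n))"
  unfolding stat_def process_edges_upd_Suc ..

lemma noise_upd: "noise \<phi> n (u(n := a)) (v(n := b)) = noise \<phi> n u v"
  by (rule depends_belowD[OF depends_below_noise[OF order_refl]]) auto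

lemma drift_upd: "drift \<phi> n (u(n := a)) (v(n := b)) = drift \<phi> n u v"
  by (rule depends_belowD[OF depends_below_drift[OF order_refl]]) auto

lemma stat_upd: "stat \<phi> n (u(n := a)) (v(n := b)) = stat \<phi> n u v"
  by (rule depends_belowD[OF depends_below_stat[OF order_refl]]) auto

lemma noise_Suc: "noise \<phi> (Suc n) u v = noise \<phi> n u v + (stat \<phi> (Suc n) u v - stat \<phi> n u v) - drift \<phi> n u v"
  by (simp add: noise_def)

definition jump :: "(nat \<Rightarrow> real) \<Rightarrow> nat \<Rightarrow> (nat \<Rightarrow> nat) \<Rightarrow> (nat \<Rightarrow> nat) \<Rightarrow> nat \<Rightarrow> nat \<Rightarrow> real" where
  "jump \<phi> n u v a b = degree_stat \<phi> (Suc n) (step_edges n a b (process_edges u v n))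
     - degree_stat \<phi> n (process_edges u v n)"

lemma choice_mean_jump:
  assumes "\<And>k. u k \<le> k"
  shows "choice_mean n (jump \<phi> n u v) = drift \<phi> n u v"
proof -
  have "choice_mean n (jump \<phi> n u v)
    = choice_mean n (\<lambda>a b. degree_stat \<phi> (Suc n) (step_edges n a b (process_edges u v n)) + (- stat \<phi> n u v))"
    by (simp add: jump_def[abs_def] stat_def)
  also have "\<dots> = drift \<phi> n u v"
    unfolding choice_mean_add choice_mean_const
      choice_mean_degree_stat[OF graph_on_process_edges[OF assms, of n v]]
    by (simp add: drift_def stat_def)
  finally show ?thesis .
qed

lemma noise_upd_Suc:
  "noise \<phi> (Suc n) (u(n := a)) (v(n := b)) = noise \<phi> n u v + jump \<phi> n u v a b - drift \<phi> n u v"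
  unfolding noise_Suc noise_upd drift_upd stat_upd_Suc jump_def stat_upd by (simp add: stat_def)

lemma stat_linear_square_le:
  "(stat (\<lambda>k. real k + 1) n u v)\<^sup>2 \<le> (real n + 1) * stat (\<lambda>k. (real k + 1)\<^sup>2) n u v"
  using Cauchy_Schwarz_ineq_sum[of "\<lambda>_. 1" "\<lambda>x. real (degree (process_edges u v n) x) + 1" "{..n}"]
  by (simp add: stat_def degree_stat_def add.commute)

text \<open>The recursion of the theorem is the condition that this linear function of the proportions be equal to
  the proportion of degree \<open>d\<close>: a count that grows like \<open>c N\<close> has drift \<open>c\<close>.\<close>

lemma drift_indicator:
  fixes n d :: nat
  defines "N \<equiv> real n + 1"
  shows "\<bar>drift (\<lambda>j. of_bool (j = d)) n u v
      - ((real d + 1) * ((if d = 0 then 0 else stat (\<lambda>k. of_bool (k = d - 1)) n u v / N)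
             + stat (\<lambda>k. of_bool (k = Suc d)) n u v / N) + of_bool (d = 0)
         - 2 * (real d + 1) * (stat (\<lambda>k. of_bool (k = d)) n u v / N))\<bar>
    \<le> 2 * (real d + 2)\<^sup>2 / N + stat (\<lambda>k. real k + 1) n u v / N\<^sup>2"
proof -
  have prev: "degree_stat (\<lambda>k. of_bool (k + 1 = d)) n E
    = (if d = 0 then 0 else degree_stat (\<lambda>k. of_bool (k = d - 1)) n E)" for E
    by (cases d) (simp_all add: degree_stat_def)
  have N: "N > 0" by (simp add: N_def)
  show ?thesis
    using degree_stat_transition_indicator[of n d "process_edges u v n", folded N_def, unfolded prev]
    unfolding drift_def stat_def
    by (cases "d = 0") (simp_all add: algebra_simps)
qed

lemma stat_indicator_eq_num_degree:
  "stat (\<lambda>k. of_bool (k = d)) n u v = real (num_degree u v n d)"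
  by (simp add: stat_def degree_stat_def num_degree_def of_bool_def sum.If_cases Int_def)

lemma num_degree_le: "num_degree u v n d \<le> n + 1"
proof -
  have "num_degree u v n d \<le> card {..n}"
    unfolding num_degree_def by (rule card_mono) auto
  then show ?thesis by simp
qed

context duplication_deletion_process
begin

lemma expectation_stat_Suc:
  "expectation (along (stat \<phi> (Suc n))) = expectation (along (stat (transition n \<phi>) n))"
proof -
  have "expectation (along (stat \<phi> (Suc n)))
    = expectation (along (\<lambda>u v. choice_mean n (\<lambda>a b. stat \<phi> (Suc n) (u(n := a)) (v(n := b)))))"
    by (rule expectation_along_average[OF depends_below_stat]) simp
  also have "\<dots> = expectation (along (stat (transition n \<phi>) n))"
  proof (rule expectation_along_eq)
    show "depends_below n (\<lambda>u v. choice_mean n (\<lambda>a b. stat \<phi> (Suc n) (u(n := a)) (v(n := b))))"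
      by (intro depends_below_choice_mean depends_below_upd depends_below_stat) simp
    show "depends_below n (stat (transition n \<phi>) n)" by (rule depends_below_stat) simp
    fix u v :: "nat \<Rightarrow> nat"
    assume "\<And>k. u k \<le> k"
    then show "choice_mean n (\<lambda>a b. stat \<phi> (Suc n) (u(n := a)) (v(n := b))) = stat (transition n \<phi>) n u v"
      unfolding stat_upd_Suc unfolding stat_def by (intro choice_mean_degree_stat graph_on_process_edges)
  qed
  finally show ?thesis .
qed

lemma expectation_stat_linear: "expectation (along (stat (\<lambda>k. real k + 1) n)) = 3 * real n + 1"
proof (induction n)
  case 0
  show ?case by (simp add: stat_def degree_stat_def degree_def neighbours_def prob_space)
next
  case (Suc n)
  have "stat (transition n (\<lambda>k. real k + 1)) n u v = stat (\<lambda>k. real k + 1) n u v + 3" for u v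
    unfolding stat_def transition_linear[abs_def] degree_stat_add degree_stat_const by (simp add: field_simps)
  then show ?case
    unfolding expectation_stat_Suc using integrable_along[OF depends_below_stat[OF order_refl], of "\<lambda>k. real k + 1" n] Suc
    by (simp add: prob_space)
qed

text \<open>By \<open>transition_square_le\<close> a step adds at most \<open>6\<close> times the mean of \<open>degree + 1\<close>, plus \<open>1\<close>. That
  mean is below \<open>3\<close> in expectation, which gives the constant \<open>19 = 6 * 3 + 1\<close>.\<close>

lemma expectation_stat_square: "expectation (along (stat (\<lambda>k. (real k + 1)\<^sup>2) n)) \<le> 19 * (real n + 1)"
proof (induction n)
  case 0
  show ?case by (simp add: stat_def degree_stat_def degree_def neighbours_def prob_space)
next
  case (Suc n)
  let ?N = "real n + 1"
  let ?Q = "stat (\<lambda>k. (real k + 1)\<^sup>2) n" and ?L = "stat (\<lambda>k. real k + 1) n"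
  have int: "integrable M (along ?Q)" "integrable M (along ?L)"
    by (rule integrable_along[OF depends_below_stat[OF order_refl]])+
  have le: "stat (transition n (\<lambda>k. (real k + 1)\<^sup>2)) n u v \<le> ?Q u v + (6 / ?N * ?L u v + 1)" for u v
  proof -
    have "stat (transition n (\<lambda>k. (real k + 1)\<^sup>2)) n u v
      \<le> stat (\<lambda>k. (real k + 1)\<^sup>2 + (6 / ?N * (real k + 1) + 1 / ?N)) n u v"
      unfolding stat_def
    proof (rule degree_stat_mono)
      show "transition n (\<lambda>k. (real k + 1)\<^sup>2) k \<le> (real k + 1)\<^sup>2 + (6 / ?N * (real k + 1) + 1 / ?N)" for k
        using transition_square_le[of n k] by (simp add: add_divide_distrib)
    qed
    also have "\<dots> = ?Q u v + (6 / ?N * ?L u v + 1)"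
      unfolding stat_def degree_stat_add degree_stat_cmult degree_stat_const by simp
    finally show ?thesis .
  qed
  have "expectation (along (stat (\<lambda>k. (real k + 1)\<^sup>2) (Suc n)))
    \<le> expectation (\<lambda>\<omega>. along ?Q \<omega> + (6 / ?N * along ?L \<omega> + 1))"
    unfolding expectation_stat_Suc
    by (intro integral_mono le integrable_along[OF depends_below_stat[OF order_refl]]
        Bochner_Integration.integrable_add integrable_mult_right int) simp
  also have "\<dots> = expectation (along ?Q) + (6 / ?N * (3 * real n + 1) + 1)"
    using int by (simp add: expectation_stat_linear prob_space)
  also have "\<dots> \<le> 19 * ?N + (18 + 1)"
  proof (intro add_mono Suc order_refl)
    show "6 / ?N * (3 * real n + 1) \<le> 18" by (simp add: field_simps)
  qed
  finally show ?case by simp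
qed

text \<open>The jump is at most \<open>K\<^sub>a + K\<^sub>b + 1\<close> for the sizes \<open>K\<^sub>a\<close>, \<open>K\<^sub>b\<close> of the two closed neighbourhoods
  involved, whose mean squares are at most \<open>19\<close>. The constant is \<open>117 = 6 * 19 + 3\<close>.\<close>

lemma expectation_square_jump:
  assumes \<phi>: "\<And>k. 0 \<le> \<phi> k" "\<And>k. \<phi> k \<le> 1"
  shows "expectation (along (\<lambda>u v. choice_mean n (\<lambda>a b. (jump \<phi> n u v a b)\<^sup>2))) \<le> 117"
proof -
  let ?Q = "stat (\<lambda>k. (real k + 1)\<^sup>2) n"
  have "expectation (along (\<lambda>u v. choice_mean n (\<lambda>a b. (jump \<phi> n u v a b)\<^sup>2)))
    \<le> expectation (along (\<lambda>u v. 6 / (real n + 1) * ?Q u v + 3))"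
  proof (rule expectation_along_mono)
    show "depends_below n (\<lambda>u v. choice_mean n (\<lambda>a b. (jump \<phi> n u v a b)\<^sup>2))"
      unfolding jump_def
      by (rule depends_below_comp[OF depends_below_process_edges])
    show "depends_below n (\<lambda>u v. 6 / (real n + 1) * ?Q u v + 3)"
      by (rule depends_below_comp[where f = "\<lambda>x. 6 / (real n + 1) * x + 3"]) (simp add: depends_below_stat)
    fix u v :: "nat \<Rightarrow> nat"
    assume "\<And>k. u k \<le> k"
    then show "choice_mean n (\<lambda>a b. (jump \<phi> n u v a b)\<^sup>2) \<le> 6 / (real n + 1) * ?Q u v + 3"
      using choice_mean_square_diff_le[OF graph_on_process_edges[of u n v] \<phi>]
      unfolding jump_def stat_def by simp
  qed
  also have "\<dots> = 6 / (real n + 1) * expectation (along ?Q) + 3"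
    using integrable_along[OF depends_below_stat[OF order_refl], of "\<lambda>k. (real k + 1)\<^sup>2" n]
    by (simp add: prob_space)
  also have "\<dots> \<le> 6 / (real n + 1) * (19 * (real n + 1)) + 3"
    by (intro add_mono mult_left_mono expectation_stat_square) auto
  also have "\<dots> = 117" by (simp add: field_simps)
  finally show ?thesis .
qed

text \<open>Both bounds come from averaging over the last choices a square of the form \<open>(g + jump - drift)\<^sup>2\<close>
  with \<open>g\<close> known before the step: \<open>g = 0\<close> gives the increment and \<open>g = noise\<close> the orthogonality of the
  increments.\<close>

lemma noise_second_moments:
  assumes \<phi>: "\<And>k. 0 \<le> \<phi> k" "\<And>k. \<phi> k \<le> 1"
  shows "expectation (along (\<lambda>u v. (noise \<phi> (Suc n) u v - noise \<phi> n u v)\<^sup>2)) \<le> 117"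
    and "expectation (along (\<lambda>u v. (noise \<phi> (Suc n) u v)\<^sup>2))
      \<le> expectation (along (\<lambda>u v. (noise \<phi> n u v)\<^sup>2)) + 117"
proof -
  let ?J = "\<lambda>u v. choice_mean n (\<lambda>a b. (jump \<phi> n u v a b)\<^sup>2)"
  have J: "depends_below n ?J"
    unfolding jump_def by (rule depends_below_comp[OF depends_below_process_edges])
  have general: "expectation (along (\<lambda>u v. (noise \<phi> (Suc n) u v - (noise \<phi> n u v - g u v))\<^sup>2))
      \<le> expectation (along (\<lambda>u v. (g u v)\<^sup>2)) + 117"
    if g: "depends_below n g" for g :: "(nat \<Rightarrow> nat) \<Rightarrow> (nat \<Rightarrow> nat) \<Rightarrow> real"
  proof -
    let ?F = "\<lambda>u v. (noise \<phi> (Suc n) u v - (noise \<phi> n u v - g u v))\<^sup>2"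
    have F: "depends_below (Suc n) ?F"
      by (intro depends_below_comp[where f = "\<lambda>x. x\<^sup>2"] depends_below_comp2[where f = "(-)"]
          depends_below_noise depends_below_mono[OF g]) auto
    have g2: "depends_below n (\<lambda>u v. (g u v)\<^sup>2)" by (rule depends_below_comp[OF g])
    have "expectation (along ?F)
      = expectation (along (\<lambda>u v. choice_mean n (\<lambda>a b. ?F (u(n := a)) (v(n := b)))))"
      by (rule expectation_along_average[OF F])
    also have "\<dots> \<le> expectation (along (\<lambda>u v. (g u v)\<^sup>2 + ?J u v))"
    proof (rule expectation_along_mono)
      show "depends_below n (\<lambda>u v. choice_mean n (\<lambda>a b. ?F (u(n := a)) (v(n := b))))"
        by (intro depends_below_choice_mean depends_below_upd[OF F])
      show "depends_below n (\<lambda>u v. (g u v)\<^sup>2 + ?J u v)"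
        by (intro depends_below_comp2[where f = "(+)"] g2 J)
      fix u v :: "nat \<Rightarrow> nat"
      assume u: "\<And>k. u k \<le> k"
      have "g (u(n := a)) (v(n := b)) = g u v" for a b
        by (rule depends_belowD[OF g]) auto
      then have "?F (u(n := a)) (v(n := b)) = (g u v + jump \<phi> n u v a b - choice_mean n (jump \<phi> n u v))\<^sup>2" for a b
        unfolding noise_upd_Suc noise_upd choice_mean_jump[OF u] by (simp add: algebra_simps)
      then show "choice_mean n (\<lambda>a b. ?F (u(n := a)) (v(n := b))) \<le> (g u v)\<^sup>2 + ?J u v"
        using choice_mean_square_centred[of n "g u v" "jump \<phi> n u v"] by simp
    qed
    also have "\<dots> = expectation (along (\<lambda>u v. (g u v)\<^sup>2)) + expectation (along ?J)"
      by (intro Bochner_Integration.integral_add integrable_along[OF g2] integrable_along[OF J])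
    also have "\<dots> \<le> expectation (along (\<lambda>u v. (g u v)\<^sup>2)) + 117"
      by (intro add_left_mono expectation_square_jump \<phi>)
    finally show ?thesis .
  qed
  show "expectation (along (\<lambda>u v. (noise \<phi> (Suc n) u v - noise \<phi> n u v)\<^sup>2)) \<le> 117"
    using general[of "\<lambda>_ _. 0"] by (simp add: depends_below_def)
  show "expectation (along (\<lambda>u v. (noise \<phi> (Suc n) u v)\<^sup>2))
      \<le> expectation (along (\<lambda>u v. (noise \<phi> n u v)\<^sup>2)) + 117"
    using general[OF depends_below_noise[where \<phi> = \<phi>, OF order_refl]] by simp
qed

lemma noise_slln:
  assumes \<phi>: "\<And>k. 0 \<le> \<phi> k" "\<And>k. \<phi> k \<le> 1"
  shows "AE \<omega> in M. (\<lambda>n. along (noise \<phi> n) \<omega> / (real n + 1)) \<longlonglongrightarrow> 0"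
proof (rule slln_of_second_moments[where C = 117])
  show "along (noise \<phi> n) \<in> borel_measurable M" for n
    by (rule measurable_along[OF depends_below_noise[OF order_refl]])
  show "integrable M (\<lambda>\<omega>. (along (noise \<phi> n) \<omega>)\<^sup>2)" for n
    by (rule integrable_along[OF depends_below_comp[OF depends_below_noise[OF order_refl]]])
  have "depends_below (Suc n) (\<lambda>u v. (noise \<phi> (Suc n) u v - noise \<phi> n u v)\<^sup>2)" for n
    by (intro depends_below_comp[where f = "\<lambda>x. x\<^sup>2"] depends_below_comp2[where f = "(-)"]
        depends_below_noise) auto
  then show "integrable M (\<lambda>\<omega>. (along (noise \<phi> (Suc n)) \<omega> - along (noise \<phi> n) \<omega>)\<^sup>2)" for n
    by (rule integrable_along)
  show "expectation (\<lambda>\<omega>. (along (noise \<phi> (Suc n)) \<omega> - along (noise \<phi> n) \<omega>)\<^sup>2) \<le> 117" for n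
    by (rule noise_second_moments(1)[where \<phi> = \<phi>, OF \<phi>])
  show "expectation (\<lambda>\<omega>. (along (noise \<phi> n) \<omega>)\<^sup>2) \<le> 117 * (real n + 1)" for n
  proof (induction n)
    case 0
    have "(\<phi> 0)\<^sup>2 \<le> 1" using \<phi>[of 0] by (simp add: power_le_one)
    then show ?case
      by (simp add: noise_def stat_def degree_stat_def degree_def neighbours_def prob_space)
  next
    case (Suc n)
    then show ?case using noise_second_moments(2)[where \<phi> = \<phi> and n = n, OF \<phi>] by simp
  qed
qed

text \<open>By Cauchy-Schwarz the square of the sum of \<open>degree + 1\<close> is at most \<open>N\<close> times the sum of
  \<open>(degree + 1)\<^sup>2\<close>, so the second moment of the quotient is of order \<open>1 / N\<^sup>2\<close>.\<close>

lemma mean_degree_negligible: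
  "AE \<omega> in M. (\<lambda>n. along (stat (\<lambda>k. real k + 1) n) \<omega> / (real n + 1)\<^sup>2) \<longlonglongrightarrow> 0"
proof (rule AE_tendsto_0_of_summable_second_moments)
  let ?L = "\<lambda>n. stat (\<lambda>k. real k + 1) n" and ?Q = "\<lambda>n. stat (\<lambda>k. (real k + 1)\<^sup>2) n"
  show int: "integrable M (\<lambda>\<omega>. (along (?L n) \<omega> / (real n + 1)\<^sup>2)\<^sup>2)" for n
    by (rule integrable_along[OF depends_below_comp[OF depends_below_stat[OF order_refl],
          where f = "\<lambda>x. (x / (real n + 1)\<^sup>2)\<^sup>2"]])
  show "expectation (\<lambda>\<omega>. (along (?L n) \<omega> / (real n + 1)\<^sup>2)\<^sup>2) \<le> 19 * (1 / (real n + 1)\<^sup>2)" for n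
  proof -
    let ?N = "real n + 1"
    have "expectation (\<lambda>\<omega>. (along (?L n) \<omega> / ?N\<^sup>2)\<^sup>2) \<le> expectation (\<lambda>\<omega>. 1 / ?N ^ 3 * along (?Q n) \<omega>)"
    proof (intro integral_mono int integrable_mult_right integrable_along[OF depends_below_stat[OF order_refl]])
      fix \<omega>
      have "(along (?L n) \<omega> / ?N\<^sup>2)\<^sup>2 \<le> ?N * along (?Q n) \<omega> / (?N\<^sup>2)\<^sup>2"
        unfolding power_divide by (intro divide_right_mono stat_linear_square_le) simp
      also have "\<dots> = 1 / ?N ^ 3 * along (?Q n) \<omega>" by (simp add: power2_eq_square power3_eq_cube)
      finally show "(along (?L n) \<omega> / ?N\<^sup>2)\<^sup>2 \<le> 1 / ?N ^ 3 * along (?Q n) \<omega>" .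
    qed
    also have "\<dots> = 1 / ?N ^ 3 * expectation (along (?Q n))" by simp
    also have "\<dots> \<le> 1 / ?N ^ 3 * (19 * ?N)"
      by (intro mult_left_mono expectation_stat_square) simp
    also have "\<dots> = 19 * (1 / ?N\<^sup>2)"
    proof -
      have "1 / x ^ 3 * (19 * x) = 19 * (1 / x\<^sup>2)" if "x > 0" for x :: real
        using that by (simp add: power2_eq_square power3_eq_cube)
      from this[of ?N] show ?thesis by (simp only: of_nat_0_le_iff add_nonneg_pos zero_less_one)
    qed
    finally show ?thesis .
  qed
  show "summable (\<lambda>n. 19 * (1 / (real n + 1)\<^sup>2))"
    using summable_mult[OF inverse_squares_sums[THEN sums_summable], of 19] by (simp add: add.commute)
qed

end

section \<open>Convergence of the degree proportions\<close>

text \<open>The purely deterministic conclusion for a single path whose noise and mean degree are negligible: its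
  degree proportions form an instance of the noisy system treated above.\<close>

lemma path_proportions_converge:
  assumes u: "\<And>k. u k \<le> k"
    and noise: "\<And>d. (\<lambda>n. noise (\<lambda>k. of_bool (k = d)) n u v / (real n + 1)) \<longlonglongrightarrow> 0"
    and deg: "(\<lambda>n. stat (\<lambda>k. real k + 1) n u v / (real n + 1)\<^sup>2) \<longlonglongrightarrow> 0"
  obtains c :: "nat \<Rightarrow> real" where "\<And>d. 0 \<le> c d" "\<And>d. c d \<le> 1"
    "\<And>d. (\<lambda>n. real (num_degree u v n d) / (real n + 1)) \<longlonglongrightarrow> c d"
    "\<And>d. (2 * real d + 3) * c d
      = (real d + 1) * ((if d = 0 then 0 else c (d - 1)) + c (Suc d)) + of_bool (d = 0)"
proof -
  define x where "x d n = stat (\<lambda>k. of_bool (k = d)) n u v / (real n + 1)" for d n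
  define r where "r d n = (real d + 1) * ((if d = 0 then 0 else x (d - 1) n) + x (Suc d) n)
    + of_bool (d = 0) - 2 * (real d + 1) * x d n" for d n
  define e where "e d n = drift (\<lambda>k. of_bool (k = d)) n u v - r d n" for d n
  let ?m = "\<lambda>d n. noise (\<lambda>k. of_bool (k = d)) n u v"
  have e_lim: "e d \<longlonglongrightarrow> 0" for d
  proof (rule Lim_null_comparison)
    show "\<forall>\<^sub>F n in sequentially. norm (e d n)
      \<le> 2 * (real d + 2)\<^sup>2 / (real n + 1) + stat (\<lambda>k. real k + 1) n u v / (real n + 1)\<^sup>2"
    proof (rule always_eventually, rule allI)
      show "norm (e d n)
        \<le> 2 * (real d + 2)\<^sup>2 / (real n + 1) + stat (\<lambda>k. real k + 1) n u v / (real n + 1)\<^sup>2" for n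
        using drift_indicator[of d n u v] by (simp only: e_def r_def x_def real_norm_def)
    qed
    have "(\<lambda>n. 2 * (real d + 2)\<^sup>2 / (real n + 1)) \<longlonglongrightarrow> 0"
      using LIMSEQ_Suc[OF lim_const_over_n[of "2 * (real d + 2)\<^sup>2"]] by (simp add: add.commute)
    from tendsto_add[OF this deg]
    show "(\<lambda>n. 2 * (real d + 2)\<^sup>2 / (real n + 1) + stat (\<lambda>k. real k + 1) n u v / (real n + 1)\<^sup>2) \<longlonglongrightarrow> 0"
      by simp
  qed
  have rec: "(real n + 2) * x d (Suc n) - ?m d (Suc n)
      = (real n + 1) * x d n - ?m d n - 2 * (real d + 1) * x d n
        + ((real d + 1) * ((if d = 0 then 0 else x (d - 1) n) + x (Suc d) n) + of_bool (d = 0) + e d n)" for d n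
  proof -
    have s: "(real n + 1) * x d n = stat (\<lambda>k. of_bool (k = d)) n u v" for n by (simp add: x_def)
    have "(real n + 2) * x d (Suc n) - ?m d (Suc n)
      = (real n + 1) * x d n - ?m d n + drift (\<lambda>k. of_bool (k = d)) n u v"
      using s[of "Suc n"] s[of n] by (simp add: noise_Suc add.commute add.left_commute)
    also have "drift (\<lambda>k. of_bool (k = d)) n u v = r d n + e d n" by (simp add: e_def)
    finally show ?thesis by (simp add: r_def)
  qed
  have x01: "0 \<le> x d n" "x d n \<le> 1" for d n
    using num_degree_le[of u v n d] by (simp_all add: x_def stat_indicator_eq_num_degree)
  obtain c where c: "\<And>d. 0 \<le> c d" "\<And>d. c d \<le> 1" "\<And>d. x d \<longlonglongrightarrow> c d"
    "\<And>d. (2 * real d + 3) * c d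
      = (real d + 1) * ((if d = 0 then 0 else c (d - 1)) + c (Suc d)) + of_bool (d = 0)"
    using noisy_system_converges[of x ?m e, OF x01 noise e_lim rec] by blast
  show ?thesis
  proof (rule that[OF c(1,2) _ c(4)])
    show "(\<lambda>n. real (num_degree u v n d) / (real n + 1)) \<longlonglongrightarrow> c d" for d
      using c(3)[of d] by (simp add: x_def[abs_def] stat_indicator_eq_num_degree)
  qed
qed

theorem theorem1:
  fixes M :: "'a measure" and U V :: "nat \<Rightarrow> 'a \<Rightarrow> nat"
  assumes "duplication_deletion_process M U V"
  defines "X \<equiv> \<lambda>n d \<omega>. num_degree (\<lambda>k. U k \<omega>) (\<lambda>k. V k \<omega>) n d"
  shows "\<exists>c :: nat \<Rightarrow> real.
    (\<forall>d. c d > 0) \<and>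
    (\<forall>d. AE \<omega> in M. (\<lambda>n. real (X n d \<omega>) / real (n + 1)) \<longlonglongrightarrow> c d) \<and>
    c 0 = (1 + c 1) / 3 \<and>
    (\<forall>d\<ge>1. c d = real (d + 1) / real (2 * d + 3) * (c (d - 1) + c (d + 1)))"
proof -
  interpret duplication_deletion_process M U V by (rule assms(1))
  let ?sol = "\<lambda>c :: nat \<Rightarrow> real. (\<forall>d. 0 \<le> c d \<and> c d \<le> 1) \<and> (\<forall>d. (2 * real d + 3) * c d
      = (real d + 1) * ((if d = 0 then 0 else c (d - 1)) + c (Suc d)) + of_bool (d = 0))"
  have "AE \<omega> in M. \<forall>d. (\<lambda>n. along (noise (\<lambda>k. of_bool (k = d)) n) \<omega> / (real n + 1)) \<longlonglongrightarrow> 0"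
    unfolding AE_all_countable by (intro allI noise_slln) auto
  with AE_choices_le mean_degree_negligible
  have ae: "AE \<omega> in M. \<exists>c. ?sol c \<and> (\<forall>d. (\<lambda>n. real (X n d \<omega>) / (real n + 1)) \<longlonglongrightarrow> c d)"
  proof eventually_elim
    case (elim \<omega>)
    have noise: "(\<lambda>n. along (noise (\<lambda>k. of_bool (k = d)) n) \<omega> / (real n + 1)) \<longlonglongrightarrow> 0" for d
      using elim by blast
    have le: "U k \<omega> \<le> k" for k using elim by blast
    obtain c where c: "\<And>d. 0 \<le> c d" "\<And>d. c d \<le> 1"
      "\<And>d. (\<lambda>n. real (along num_degree \<omega> n d) / (real n + 1)) \<longlonglongrightarrow> c d"
      "\<And>d. (2 * real d + 3) * c d
        = (real d + 1) * ((if d = 0 then 0 else c (d - 1)) + c (Suc d)) + of_bool (d = 0)"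
      using path_proportions_converge[where u = "\<lambda>k. U k \<omega>" and v = "\<lambda>k. V k \<omega>", OF le noise]
        elim by blast
    have "?sol c" by (intro conjI allI c)
    moreover have "\<forall>d. (\<lambda>n. real (X n d \<omega>) / (real n + 1)) \<longlonglongrightarrow> c d"
      using c(3) by (simp add: X_def)
    ultimately show ?case by blast
  qed
  \<comment> \<open>The witness comes from the process itself: the limits along any one good path will do, by uniqueness.\<close>
  have "ae_filter M \<noteq> bot" by (simp add: ae_filter_eq_bot_iff emeasure_space_1)
  from eventually_happens'[OF this ae] obtain c where c: "?sol c" by blast
  have lim: "AE \<omega> in M. \<forall>d. (\<lambda>n. real (X n d \<omega>) / (real n + 1)) \<longlonglongrightarrow> c d"
    using ae
  proof eventually_elim
    case (elim \<omega>)
    then obtain c' where c': "?sol c'" "\<forall>d. (\<lambda>n. real (X n d \<omega>) / (real n + 1)) \<longlonglongrightarrow> c' d"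
      by blast
    have "c' = c" using c c'(1) by (intro bounded_solution_unique) auto
    with c'(2) show ?case by simp
  qed
  have c0: "c 0 = (1 + c 1) / 3" using c[THEN conjunct2, rule_format, of 0] by simp
  have cd: "c d = real (d + 1) / real (2 * d + 3) * (c (d - 1) + c (d + 1))" if "d \<ge> 1" for d
    using c[THEN conjunct2, rule_format, of d] that by (simp add: field_simps)
  have "c d > 0" for d
  proof (induction d)
    case 0
    have "0 \<le> c 1" using c by blast
    then show ?case unfolding c0 by simp
  next
    case (Suc d)
    have "0 \<le> c (Suc (Suc d))" using c by blast
    then show ?case using cd[of "Suc d"] Suc by (simp add: add_pos_nonneg)
  qed
  moreover have "AE \<omega> in M. (\<lambda>n. real (X n d \<omega>) / real (n + 1)) \<longlonglongrightarrow> c d" for d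
    using lim by eventually_elim (simp add: add.commute)
  ultimately show ?thesis using c0 cd by blast
qed

end
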